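(* Let $\mathbb{K}\in\{\mathbb{R},\mathbb{C}\}$, let $V$ be a finite-dimensional $\mathbb{K}$-vector space, let $\mathfrak{r}\subset\mathbb{K}[\mathcal{S}_3]$ be a minimal right ideal belonging to the partition $(2\,1)\vdash 3$, and let $\mathcal{T}_{\mathfrak{r}}$ be the symmetry class of tensors $U\in\mathcal{T}_3V$ defined by $\mathfrak{r}$. Then the following statements are equivalent: (1) $\mathcal{A}(V)=\mathrm{Span}\{y_t^{\ast}(U\otimes w)\,|\,U\in\mathcal{T}_{\mathfrak{r}},\,w\in\mathcal{T}_1V\}$. (2) $\mathcal{A}'(V)=\mathrm{Span}\{y_{t'}^{\ast}(U\otimes S)\,|\,U\in\mathcal{T}_{\mathfrak{r}},\,S\in\mathcal{S}^2(V)\}$. (3) $\mathcal{A}'(V)=\mathrm{Span}\{y_{t'}^{\ast}(U\otimes A)\,|\,U\in\mathcal{T}_{\mathfrak{r}},\,A\in\Lambda^2(V)\}$. (4) $\mathfrak{r}$ is different from the right ideal $\mathfrak{r}_0=f_0\cdot\mathbb{K}[\mathcal{S}_3]$ generated by the idempotent $$f_0:=\tfrac12\{\mathrm{id}-(1\,3)\}-\tfrac16\,y,\qquad y:=\sum_{p\in\mathcal{S}_3}\mathrm{sign}(p)\,p .$$ Here $y_t$ and $y_{t'}$ are the Young symmetrizers of the Young tableaux $t$ with rows $(1,3),(2,4)$ and $t'$ with rows $(1,3,5),(2,4)$.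
   Context: $\mathcal{T}_rV$ is the space of $r$-times covariant tensors on $V$; $\mathcal{S}^2(V)$, $\Lambda^2(V)\subset\mathcal{T}_2V$ are the symmetric, resp. alternating, 2-forms. $\mathcal{A}(V)\subset\mathcal{T}_4V$ is the space of algebraic curvature tensors, i.e. all $R$ with $R(w,x,y,z)=-R(w,x,z,y)=R(y,z,w,x)$ and $R(w,x,y,z)+R(w,y,z,x)+R(w,z,x,y)=0$. $\mathcal{A}'(V)\subset\mathcal{T}_5V$ is the space of algebraic covariant derivative curvature tensors, i.e. all $R'$ with $R'(w,x,y,z;u)=-R'(w,x,z,y;u)=R'(y,z,w,x;u)$, $R'(w,x,y,z;u)+R'(w,y,z,x;u)+R'(w,z,x,y;u)=0$ and $R'(w,x,y,z;u)+R'(w,x,z,u;y)+R'(w,x,u,y;z)=0$. A group ring element $a=\sum_{p\in\mathcal{S}_r}a(p)\,p\in\mathbb{K}[\mathcal{S}_r]$ acts on $T\in\mathcal{T}_rV$ by $(aT)(v_1,\dots,v_r)=\sum_p a(p)\,T(v_{p(1)},\dots,v_{p(r)})$, equivalently $(aT)_{i_1\dots i_r}=\sum_p a(p)T_{i_{p(1)}\dots i_{p(r)}}$. Products of permutations are $(p\circ q)(i)=p(q(i))$, and $a^{\ast}:=\sum_p a(p)\,p^{-1}$. The Young symmetrizer of a Young tableau $t$ is $y_t=\sum_{p\in\mathcal{H}_t}\sum_{q\in\mathcal{V}_t}\mathrm{sign}(q)\,p\circ q$, where $\mathcal{H}_t$, $\mathcal{V}_t$ are the groups of permutations that permute numbers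 only within the rows, resp. columns, of $t$. The symmetry class of a right ideal $\mathfrak{r}\subseteq\mathbb{K}[\mathcal{S}_r]$ is $\mathcal{T}_{\mathfrak{r}}=\{aT\,|\,a\in\mathfrak{r},\,T\in\mathcal{T}_rV\}$; by definition the notion is used only when $aT\ne0$ for some $a\in\mathfrak{r}$, $T\in\mathcal{T}_rV$ (for $\mathfrak{r}$ belonging to $(2\,1)$ this means $\dim V\ge2$, which is assumed). A minimal right ideal belongs to $\lambda\vdash r$ if it lies in the minimal two-sided ideal of $\mathbb{K}[\mathcal{S}_r]$ corresponding to $\lambda$, i.e. the one containing the Young symmetrizers of all tableaux of frame $\lambda$. *)

theory Defs
  imports
    Complex_Main
    "HOL-Library.Function_Algebras"
    "HOL-Combinatorics.Permutations"
    "HOL-Algebra.Ideal"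
begin

definition field_iso :: "('k::field \<Rightarrow> 'l::field) \<Rightarrow> bool" where
  "field_iso \<phi> \<longleftrightarrow> bij \<phi> \<and> \<phi> 1 = 1 \<and>
     (\<forall>x y. \<phi> (x + y) = \<phi> x + \<phi> y) \<and> (\<forall>x y. \<phi> (x * y) = \<phi> x * \<phi> y)"

subsection \<open>The group ring of the symmetric group\<close>

text \<open>An element of the group ring of the symmetric group on \<open>{1..n}\<close> is its coefficient function,
  which vanishes outside the permutations of \<open>{1..n}\<close>.\<close>

definition perm_elt :: "(nat \<Rightarrow> nat) \<Rightarrow> (nat \<Rightarrow> nat) \<Rightarrow> 'k::field" where
  "perm_elt p = (\<lambda>s. if s = p then 1 else 0)"

definition group_ring :: "nat \<Rightarrow> ((nat \<Rightarrow> nat) \<Rightarrow> 'k::field) ring" where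
  "group_ring n =
     \<lparr> carrier = {a. \<forall>s. \<not> s permutes {1..n} \<longrightarrow> a s = 0},
       mult = (\<lambda>a b s. \<Sum>p | p permutes {1..n}. \<Sum>q | q permutes {1..n}.
                  a p * b q * perm_elt (p \<circ> q) s),
       one = perm_elt id,
       zero = (\<lambda>s. 0),
       add = (\<lambda>a b s. a s + b s) \<rparr>"

definition gr_star :: "nat \<Rightarrow> ((nat \<Rightarrow> nat) \<Rightarrow> 'k::field) \<Rightarrow> (nat \<Rightarrow> nat) \<Rightarrow> 'k" where
  "gr_star n a = (\<lambda>s. \<Sum>p | p permutes {1..n}. a p * perm_elt (Hilbert_Choice.inv p) s)"

lemma group_ring_mult_apply:
  fixes a b :: "(nat \<Rightarrow> nat) \<Rightarrow> 'k::field"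
  assumes "s permutes {1..n}"
  shows "(a \<otimes>\<^bsub>group_ring n\<^esub> b) s = (\<Sum>p | p permutes {1..n}. a p * b (Hilbert_Choice.inv p \<circ> s))"
proof -
  have "(\<Sum>q | q permutes {1..n}. a p * b q * perm_elt (p \<circ> q) s)
      = a p * b (Hilbert_Choice.inv p \<circ> s)" if p: "p permutes {1..n}" for p
  proof -
    have eq: "s = p \<circ> q \<longleftrightarrow> q = Hilbert_Choice.inv p \<circ> s" for q
      using permutes_inv_o[OF p] by (metis comp_assoc id_comp)
    have "(\<Sum>q | q permutes {1..n}. a p * b q * perm_elt (p \<circ> q) s)
        = (\<Sum>q | q permutes {1..n}. if q = Hilbert_Choice.inv p \<circ> s then a p * b q else 0)"
      by (rule sum.cong) (auto simp: perm_elt_def eq)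
    also have "\<dots> = a p * b (Hilbert_Choice.inv p \<circ> s)"
      using permutes_compose[OF assms permutes_inv[OF p]]
      by (simp add: sum.delta finite_permutations)
    finally show ?thesis .
  qed
  then show ?thesis by (simp add: group_ring_def)
qed

lemma group_ring_mult_outside:
  "\<not> s permutes {1..n} \<Longrightarrow> (a \<otimes>\<^bsub>group_ring n\<^esub> b) s = 0"
  by (auto simp: group_ring_def perm_elt_def permutes_compose intro!: sum.neutral)

lemma group_ring_is_ring: "ring (group_ring n :: ((nat \<Rightarrow> nat) \<Rightarrow> 'k::field) ring)"
proof -
  let ?R = "group_ring n :: ((nat \<Rightarrow> nat) \<Rightarrow> 'k) ring"
  let ?P = "{p. p permutes {1..n}}"
  have closed: "a \<otimes>\<^bsub>?R\<^esub> b \<in> carrier ?R" for a b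
    using group_ring_mult_outside[of _ n a b] by (simp add: group_ring_def)
  have assoc: "(a \<otimes>\<^bsub>?R\<^esub> b) \<otimes>\<^bsub>?R\<^esub> c = a \<otimes>\<^bsub>?R\<^esub> (b \<otimes>\<^bsub>?R\<^esub> c)" for a b c
  proof
    fix s
    show "((a \<otimes>\<^bsub>?R\<^esub> b) \<otimes>\<^bsub>?R\<^esub> c) s = (a \<otimes>\<^bsub>?R\<^esub> (b \<otimes>\<^bsub>?R\<^esub> c)) s"
    proof (cases "s permutes {1..n}")
      case True
      have "((a \<otimes>\<^bsub>?R\<^esub> b) \<otimes>\<^bsub>?R\<^esub> c) s
          = (\<Sum>p\<in>?P. (\<Sum>q\<in>?P. a q * b (Hilbert_Choice.inv q \<circ> p)) * c (Hilbert_Choice.inv p \<circ> s))"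
        unfolding group_ring_mult_apply[OF True]
        by (rule sum.cong) (auto simp: group_ring_mult_apply)
      also have "\<dots> = (\<Sum>q\<in>?P. \<Sum>p\<in>?P. a q * (b (Hilbert_Choice.inv q \<circ> p) * c (Hilbert_Choice.inv p \<circ> s)))"
        by (simp only: sum_distrib_right mult.assoc) (rule sum.swap)
      also have "\<dots> = (\<Sum>q\<in>?P. a q * (b \<otimes>\<^bsub>?R\<^esub> c) (Hilbert_Choice.inv q \<circ> s))"
      proof (rule sum.cong[OF refl])
        fix q assume "q \<in> ?P"
        then have q: "q permutes {1..n}" by simp
        have "(\<Sum>p\<in>?P. a q * (b (Hilbert_Choice.inv q \<circ> p) * c (Hilbert_Choice.inv p \<circ> s)))
           = (\<Sum>p\<in>?P. a q * (b p * c (Hilbert_Choice.inv p \<circ> (Hilbert_Choice.inv q \<circ> s))))"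
        proof (rule sum.reindex_bij_witness[where i = "\<lambda>p. q \<circ> p" and j = "\<lambda>p. Hilbert_Choice.inv q \<circ> p"])
          fix p assume "p \<in> ?P"
          then have p: "p permutes {1..n}" by simp
          show "q \<circ> (Hilbert_Choice.inv q \<circ> p) = p"
            by (simp add: comp_assoc[symmetric] permutes_inv_o[OF q])
          show "Hilbert_Choice.inv q \<circ> (q \<circ> p) = p"
            by (simp add: comp_assoc[symmetric] permutes_inv_o[OF q])
          show "Hilbert_Choice.inv q \<circ> p \<in> ?P"
            using permutes_compose[OF p permutes_inv[OF q]] by simp
          show "q \<circ> p \<in> ?P" using permutes_compose[OF p q] by simp
          have "Hilbert_Choice.inv (Hilbert_Choice.inv q \<circ> p) = Hilbert_Choice.inv p \<circ> q"
            using p q by (simp add: o_inv_distrib permutes_bij bij_imp_bij_inv permutes_inv_inv)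
          then have "Hilbert_Choice.inv (Hilbert_Choice.inv q \<circ> p) \<circ> (Hilbert_Choice.inv q \<circ> s)
              = Hilbert_Choice.inv p \<circ> (q \<circ> Hilbert_Choice.inv q) \<circ> s"
            by (simp add: comp_assoc)
          then show "a q * (b (Hilbert_Choice.inv q \<circ> p) *
               c (Hilbert_Choice.inv (Hilbert_Choice.inv q \<circ> p) \<circ> (Hilbert_Choice.inv q \<circ> s)))
             = a q * (b (Hilbert_Choice.inv q \<circ> p) * c (Hilbert_Choice.inv p \<circ> s))"
            by (simp add: permutes_inv_o[OF q])
        qed
        then show "(\<Sum>p\<in>?P. a q * (b (Hilbert_Choice.inv q \<circ> p) * c (Hilbert_Choice.inv p \<circ> s)))
            = a q * (b \<otimes>\<^bsub>?R\<^esub> c) (Hilbert_Choice.inv q \<circ> s)"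
          unfolding group_ring_mult_apply[OF permutes_compose[OF True permutes_inv[OF q]]]
          by (simp add: sum_distrib_left)
      qed
      also have "\<dots> = (a \<otimes>\<^bsub>?R\<^esub> (b \<otimes>\<^bsub>?R\<^esub> c)) s"
        by (simp add: group_ring_mult_apply[OF True])
      finally show ?thesis .
    qed (simp add: group_ring_mult_outside)
  qed
  have one_left: "\<one>\<^bsub>?R\<^esub> \<otimes>\<^bsub>?R\<^esub> a = a" if a: "a \<in> carrier ?R" for a
  proof
    fix s
    show "(\<one>\<^bsub>?R\<^esub> \<otimes>\<^bsub>?R\<^esub> a) s = a s"
    proof (cases "s permutes {1..n}")
      case True
      have "(\<one>\<^bsub>?R\<^esub> \<otimes>\<^bsub>?R\<^esub> a) s = (\<Sum>p\<in>?P. if p = id then a s else 0)"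
        unfolding group_ring_mult_apply[OF True]
        by (rule sum.cong) (auto simp: group_ring_def perm_elt_def)
      then show ?thesis by (simp add: finite_permutations permutes_id)
    qed (use a in \<open>auto simp: group_ring_mult_outside, simp add: group_ring_def\<close>)
  qed
  have one_right: "a \<otimes>\<^bsub>?R\<^esub> \<one>\<^bsub>?R\<^esub> = a" if a: "a \<in> carrier ?R" for a
  proof
    fix s
    show "(a \<otimes>\<^bsub>?R\<^esub> \<one>\<^bsub>?R\<^esub>) s = a s"
    proof (cases "s permutes {1..n}")
      case True
      have eq: "Hilbert_Choice.inv p \<circ> s = id \<longleftrightarrow> p = s" if "p permutes {1..n}" for p
        using permutes_inv_o[OF that] by (metis comp_assoc comp_id id_comp)
      have "(a \<otimes>\<^bsub>?R\<^esub> \<one>\<^bsub>?R\<^esub>) s = (\<Sum>p\<in>?P. if p = s then a s else 0)"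
        unfolding group_ring_mult_apply[OF True]
        by (rule sum.cong) (auto simp: group_ring_def perm_elt_def eq)
      then show ?thesis using True by (simp add: finite_permutations)
    qed (use a in \<open>auto simp: group_ring_mult_outside, simp add: group_ring_def\<close>)
  qed
  show ?thesis
  proof (rule ringI)
    show "abelian_group ?R"
    proof (rule abelian_groupI)
      fix x assume "x \<in> carrier ?R"
      then show "\<exists>y\<in>carrier ?R. y \<oplus>\<^bsub>?R\<^esub> x = \<zero>\<^bsub>?R\<^esub>"
        by (intro bexI[of _ "\<lambda>s. - x s"]) (auto simp: group_ring_def)
    qed (auto simp: group_ring_def algebra_simps)
    show "Group.monoid ?R"
      by (rule Group.monoidI)
        (use closed assoc one_left one_right in \<open>auto simp: permutes_id group_ring_def perm_elt_def\<close>)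
    fix x y z
    show "(x \<oplus>\<^bsub>?R\<^esub> y) \<otimes>\<^bsub>?R\<^esub> z = x \<otimes>\<^bsub>?R\<^esub> z \<oplus>\<^bsub>?R\<^esub> y \<otimes>\<^bsub>?R\<^esub> z"
      by (simp add: group_ring_def sum.distrib algebra_simps)
    show "z \<otimes>\<^bsub>?R\<^esub> (x \<oplus>\<^bsub>?R\<^esub> y) = z \<otimes>\<^bsub>?R\<^esub> x \<oplus>\<^bsub>?R\<^esub> z \<otimes>\<^bsub>?R\<^esub> y"
      by (simp add: group_ring_def sum.distrib algebra_simps)
  qed
qed

subsection \<open>Right ideals\<close>

definition right_ideal :: "'a set \<Rightarrow> ('a, 'b) ring_scheme \<Rightarrow> bool" where
  "right_ideal I R \<longleftrightarrow> additive_subgroup I R \<and> (\<forall>a\<in>I. \<forall>x\<in>carrier R. a \<otimes>\<^bsub>R\<^esub> x \<in> I)"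

definition minimal_right_ideal :: "'a set \<Rightarrow> ('a, 'b) ring_scheme \<Rightarrow> bool" where
  "minimal_right_ideal I R \<longleftrightarrow> right_ideal I R \<and> I \<noteq> {\<zero>\<^bsub>R\<^esub>} \<and>
     (\<forall>J. right_ideal J R \<and> J \<subseteq> I \<longrightarrow> J = {\<zero>\<^bsub>R\<^esub>} \<or> J = I)"

definition minimal_ideal :: "'a set \<Rightarrow> ('a, 'b) ring_scheme \<Rightarrow> bool" where
  "minimal_ideal I R \<longleftrightarrow> ideal I R \<and> I \<noteq> {\<zero>\<^bsub>R\<^esub>} \<and>
     (\<forall>J. ideal J R \<and> J \<subseteq> I \<longrightarrow> J = {\<zero>\<^bsub>R\<^esub>} \<or> J = I)"

subsection \<open>Young tableaux and Young symmetrizers\<close>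

text \<open>A tableau is the list of its rows; a partition is the list of its parts in decreasing
  order.\<close>

definition is_partition :: "nat list \<Rightarrow> nat \<Rightarrow> bool" where
  "is_partition l n \<longleftrightarrow> sorted_wrt (\<ge>) l \<and> 0 \<notin> set l \<and> sum_list l = n"

definition tableau :: "nat list \<Rightarrow> nat list list \<Rightarrow> bool" where
  "tableau l t \<longleftrightarrow> is_partition l (sum_list l) \<and> map length t = l \<and>
     distinct (concat t) \<and> set (concat t) = {1..sum_list l}"

definition column :: "nat list list \<Rightarrow> nat \<Rightarrow> nat set" where
  "column t j = {t ! i ! j | i. i < length t \<and> j < length (t ! i)}"

definition row_group :: "nat list list \<Rightarrow> (nat \<Rightarrow> nat) set" where
  "row_group t = {p. p permutes set (concat t) \<and> (\<forall>row\<in>set t. p ` set row = set row)}"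

definition column_group :: "nat list list \<Rightarrow> (nat \<Rightarrow> nat) set" where
  "column_group t = {p. p permutes set (concat t) \<and> (\<forall>j. p ` column t j = column t j)}"

definition young_symmetrizer :: "nat list list \<Rightarrow> (nat \<Rightarrow> nat) \<Rightarrow> 'k::field" where
  "young_symmetrizer t =
     (\<lambda>s. \<Sum>p\<in>row_group t. \<Sum>q\<in>column_group t. of_int (sign q) * perm_elt (p \<circ> q) s)"

definition belongs_to :: "((nat \<Rightarrow> nat) \<Rightarrow> 'k::field) set \<Rightarrow> nat list \<Rightarrow> bool" where
  "belongs_to \<rr> l \<longleftrightarrow>
     (\<exists>J. minimal_ideal J (group_ring (sum_list l)) \<and>
          (\<forall>t. tableau l t \<longrightarrow> young_symmetrizer t \<in> J) \<and> \<rr> \<subseteq> J)"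

subsection \<open>Covariant tensors\<close>

text \<open>An \<open>r\<close>-tuple \<open>(v 1, \<dots>, v r)\<close> of vectors is given by a sequence \<open>v\<close> whose other entries are
  irrelevant. Thus an \<open>r\<close>-times covariant tensor is a function of sequences depending only on the
  entries at \<open>1, \<dots>, r\<close> and linear in each of them.\<close>

definition tensors :: "('k::field \<Rightarrow> 'v::ab_group_add \<Rightarrow> 'v) \<Rightarrow> nat \<Rightarrow> ((nat \<Rightarrow> 'v) \<Rightarrow> 'k) set" where
  "tensors scale r =
     {T. (\<forall>v v'. (\<forall>i\<in>{1..r}. v i = v' i) \<longrightarrow> T v = T v') \<and>
         (\<forall>i\<in>{1..r}. \<forall>v. Vector_Spaces.linear scale (*) (\<lambda>x. T (v(i := x))))}"

definition tensor_span :: "((nat \<Rightarrow> 'v) \<Rightarrow> 'k::field) set \<Rightarrow> ((nat \<Rightarrow> 'v) \<Rightarrow> 'k) set" where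
  "tensor_span = module.span (\<lambda>c T v. c * T v)"

text \<open>\<open>tensor_prod r T S\<close> is the tensor product of \<open>T\<close> with \<open>S\<close>, where \<open>r\<close> is the order of \<open>T\<close>.\<close>

definition tensor_prod ::
    "nat \<Rightarrow> ((nat \<Rightarrow> 'v) \<Rightarrow> 'k::field) \<Rightarrow> ((nat \<Rightarrow> 'v) \<Rightarrow> 'k) \<Rightarrow> (nat \<Rightarrow> 'v) \<Rightarrow> 'k" where
  "tensor_prod r T S = (\<lambda>v. T v * S (\<lambda>i. v (r + i)))"

definition gr_act ::
    "nat \<Rightarrow> ((nat \<Rightarrow> nat) \<Rightarrow> 'k::field) \<Rightarrow> ((nat \<Rightarrow> 'v) \<Rightarrow> 'k) \<Rightarrow> (nat \<Rightarrow> 'v) \<Rightarrow> 'k" where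
  "gr_act r a T = (\<lambda>v. \<Sum>p | p permutes {1..r}. a p * T (\<lambda>i. v (p i)))"

definition symmetry_class :: "('k::field \<Rightarrow> 'v::ab_group_add \<Rightarrow> 'v) \<Rightarrow> nat \<Rightarrow>
    ((nat \<Rightarrow> nat) \<Rightarrow> 'k) set \<Rightarrow> ((nat \<Rightarrow> 'v) \<Rightarrow> 'k) set" where
  "symmetry_class scale r \<rr> = {gr_act r a T | a T. a \<in> \<rr> \<and> T \<in> tensors scale r}"

definition tuple :: "'v list \<Rightarrow> nat \<Rightarrow> 'v" where
  "tuple vs = (\<lambda>i. vs ! (i - 1))"

definition sym_forms :: "('k::field \<Rightarrow> 'v::ab_group_add \<Rightarrow> 'v) \<Rightarrow> ((nat \<Rightarrow> 'v) \<Rightarrow> 'k) set" where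
  "sym_forms scale = {S \<in> tensors scale 2. \<forall>x y. S (tuple [x, y]) = S (tuple [y, x])}"

definition alt_forms :: "('k::field \<Rightarrow> 'v::ab_group_add \<Rightarrow> 'v) \<Rightarrow> ((nat \<Rightarrow> 'v) \<Rightarrow> 'k) set" where
  "alt_forms scale = {A \<in> tensors scale 2. \<forall>x y. A (tuple [x, y]) = - A (tuple [y, x])}"

definition curv_tensors :: "('k::field \<Rightarrow> 'v::ab_group_add \<Rightarrow> 'v) \<Rightarrow> ((nat \<Rightarrow> 'v) \<Rightarrow> 'k) set" where
  "curv_tensors scale = {R \<in> tensors scale 4. \<forall>w x y z.
     R (tuple [w, x, y, z]) = - R (tuple [w, x, z, y]) \<and>
     R (tuple [w, x, y, z]) = R (tuple [y, z, w, x]) \<and>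
     R (tuple [w, x, y, z]) + R (tuple [w, y, z, x]) + R (tuple [w, z, x, y]) = 0}"

definition deriv_curv_tensors ::
    "('k::field \<Rightarrow> 'v::ab_group_add \<Rightarrow> 'v) \<Rightarrow> ((nat \<Rightarrow> 'v) \<Rightarrow> 'k) set" where
  "deriv_curv_tensors scale = {R \<in> tensors scale 5. \<forall>w x y z u.
     R (tuple [w, x, y, z, u]) = - R (tuple [w, x, z, y, u]) \<and>
     R (tuple [w, x, y, z, u]) = R (tuple [y, z, w, x, u]) \<and>
     R (tuple [w, x, y, z, u]) + R (tuple [w, y, z, x, u]) + R (tuple [w, z, x, y, u]) = 0 \<and>
     R (tuple [w, x, y, z, u]) + R (tuple [w, x, z, u, y]) + R (tuple [w, x, u, y, z]) = 0}"

subsection \<open>The exceptional right ideal\<close>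

definition f0 :: "(nat \<Rightarrow> nat) \<Rightarrow> 'k::field" where
  "f0 = (\<lambda>s. 1 / 2 * (perm_elt id s - perm_elt (Transposition.transpose 1 3) s)
           - 1 / 6 * (\<Sum>p | p permutes {1..3}. of_int (sign p) * perm_elt p s))"

definition r0 :: "((nat \<Rightarrow> nat) \<Rightarrow> 'k::field) set" where
  "r0 = {f0 \<otimes>\<^bsub>group_ring 3\<^esub> a | a. a \<in> carrier (group_ring 3)}"

end

theory Submission
  imports Defs
begin

text \<open>
  For an (algebraic or covariant derivative) curvature tensor \<open>R\<close>, every \<open>y\<^sup>* s R\<close> with \<open>y\<^sup>*\<close>
  the starred Young symmetrizer is a multiple of \<open>R\<close>. For \<open>s\<close> in \<open>S\<^sub>3\<close> the multiples turn out to
  be the same up to the hook product (12 or 24), so \<open>y\<^sup>* a R = N c(a) R\<close> with one linear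
  functional (\<open>kernel_form\<close> below) \<open>c(a) = a(id) + a(13) - a(12) - a((13)(12))\<close> in both cases.
  Moreover \<open>y\<^sup>* s (4 5) R = 0\<close> in the derivative case, so the second factor may be symmetrized
  or alternated at will. Decomposing \<open>R\<close> along a basis, any \<open>a\<close> in the right ideal with \<open>c(a) \<noteq>
  0\<close> exhibits \<open>R\<close> as an element of each of the three spans. Within the block of \<open>(2 1)\<close> the
  largest right ideal on which \<open>c\<close> vanishes is \<open>{a. (1 3) a = -a}\<close>, and this is \<open>r\<^sub>0\<close>.
  Conversely \<open>y\<^sup>* (1 3) = y\<^sup>*\<close>, so \<open>y\<^sup>*\<close> kills the tensors coming from \<open>r\<^sub>0\<close>, whereas a 2-form
  \<open>\<omega>\<close> and a linear form \<open>\<alpha>\<close> dividing \<open>\<omega>\<close> give nonzero curvature tensors \<open>\<omega> \<otimes> \<omega>\<close> and \<open>\<omega> \<otimes> \<omega> \<otimes> \<alpha>\<close>.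
\<close>

subsection \<open>The symmetric group on three letters and its group ring\<close>

lemma sum_permutes_2:
  assumes "a \<noteq> b"
  shows "(\<Sum>p | p permutes {a, b}. f p) = f id + f (transpose a b)"
  using assms by (subst sum_over_permutations_insert) (simp_all add: add.commute)

lemma sum_permutes_3:
  assumes "a \<noteq> b" "a \<noteq> c" "b \<noteq> c"
  shows "(\<Sum>p | p permutes {a, b, c}. f p) =
    f id + f (transpose a b) + f (transpose a c) + f (transpose b c)
    + f (transpose a b \<circ> transpose b c) + f (transpose a c \<circ> transpose b c)"
proof -
  have "(\<Sum>p | p permutes {a, b, c}. f p) =
      (\<Sum>x\<in>{a, b, c}. \<Sum>q | q permutes {b, c}. f (transpose a x \<circ> q))"
    by (rule sum_over_permutations_insert) (use assms in auto)
  then show ?thesis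
    using assms by (simp add: sum_permutes_2[OF assms(3)] add.assoc add.commute add.left_commute)
qed

definition s12 :: "nat \<Rightarrow> nat" where "s12 = transpose 1 2"
definition s13 :: "nat \<Rightarrow> nat" where "s13 = transpose 1 3"
definition s23 :: "nat \<Rightarrow> nat" where "s23 = transpose 2 3"

text \<open>Oriented as rewrite rules that push \<open>s13\<close> to the left. The normal forms are
  \<open>id\<close>, \<open>s12\<close>, \<open>s23\<close>, each with or without \<open>s13\<close>
  in front. They come in pairs \<open>s\<close>, \<open>s13 \<circ> s\<close>, and the exceptional
  right ideal is antisymmetric under exactly this pairing.\<close>

lemma S3_compose:
  "s13 \<circ> s13 = id" "s12 \<circ> s12 = id" "s23 \<circ> s23 = id"
  "s12 \<circ> s13 = s13 \<circ> s23" "s23 \<circ> s13 = s13 \<circ> s12" "s12 \<circ> s23 = s13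
      \<circ> s12" "s23 \<circ> s12 = s13 \<circ> s23"
  by (auto simp: s12_def s13_def s23_def fun_eq_iff transpose_def)

lemma permutes_S3:
  "s12 permutes {1..3}" "s13 permutes {1..3}" "s23 permutes {1..3}"
  "s13 \<circ> s12 permutes {1..3}" "s13 \<circ> s23 permutes {1..3}"
  by (auto simp: s12_def s13_def s23_def intro!: permutes_swap_id permutes_compose)

lemma sum_S3:
  "(\<Sum>p | p permutes {1..3}. f p) =
    f id + f s13 + f s12 + f (s13 \<circ> s12) + f s23 + f (s13 \<circ> s23)"
proof -
  have "{1..3} = {1, 3, 2::nat}" by auto
  moreover have "transpose 3 2 = s23" "transpose 1 3 = s13" "transpose 1 2 = s12"
    by (simp_all add: s12_def s13_def s23_def transpose_commute)
  ultimately show ?thesis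
    using sum_permutes_3[of 1 3 2 f]
    by (simp add: S3_compose add.assoc add.commute add.left_commute)
qed

lemma S3_cases:
  assumes "p permutes {1..3}"
  obtains "p = id" | "p = s13" | "p = s12" | "p = s13 \<circ> s12" | "p = s23" | "p = s13 \<circ> s23"
proof -
  \<comment> \<open>The indicator of \<open>p\<close> sums to 1, so \<open>p\<close> must be one of
    the six arguments of the explicit sum.\<close>
  have "(\<Sum>q | q permutes {1..3}. if q = p then 1 else 0 :: nat) = 1"
    using assms by (simp add: finite_permutations)
  then show ?thesis
    using that unfolding sum_S3 by (auto split: if_splits)
qed

abbreviation (input) KS3 :: "((nat \<Rightarrow> nat) \<Rightarrow> 'k::field) ring" where "KS3
    \<equiv> group_ring 3"

text \<open>Right multiplication by a group element translates the coefficient function. The inverse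
  is placed so that the translation is by \<open>u\<close> itself; closure of a right ideal is used
  below in this form.\<close>

lemma group_ring_mult_perm_elt:
  assumes a: "a \<in> carrier (group_ring n)" and u: "u permutes {1..n}" and s: "s permutes {1..n}"
  shows "(a \<otimes>\<^bsub>group_ring n\<^esub> perm_elt (Hilbert_Choice.inv u)) s = a (s \<circ> u)"
proof -
  have "Hilbert_Choice.inv p \<circ> s = Hilbert_Choice.inv u \<longleftrightarrow> p = s \<circ>
      u" if "p permutes {1..n}" for p
  proof
    assume "Hilbert_Choice.inv p \<circ> s = Hilbert_Choice.inv u"
    then have "p \<circ> (Hilbert_Choice.inv p \<circ> s) \<circ> u = p \<circ> Hilbert_Choice.inv
        u \<circ> u" by simp
    then show "p = s \<circ> u"
      using permutes_inv_o[OF that] permutes_inv_o[OF u] by (metis comp_assoc comp_id id_comp)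
  next
    assume "p = s \<circ> u"
    then show "Hilbert_Choice.inv p \<circ> s = Hilbert_Choice.inv u"
      using s u by (simp add: o_inv_distrib permutes_bij permutes_inv_o comp_assoc)
  qed
  then have "(a \<otimes>\<^bsub>group_ring n\<^esub> perm_elt (Hilbert_Choice.inv u)) s
      = (\<Sum>p | p permutes {1..n}. if p = s \<circ> u then a p else 0)"
    unfolding group_ring_mult_apply[OF s] by (intro sum.cong) (auto simp: perm_elt_def)
  then show ?thesis
    using permutes_compose[OF u s] by (simp add: finite_permutations)
qed

lemma perm_elt_carrier: "p permutes {1..n} \<Longrightarrow> perm_elt p \<in> carrier (group_ring n)"
  by (auto simp: group_ring_def perm_elt_def)

section \<open>Linear characters\<close>

definition lin_char :: "((nat \<Rightarrow> nat) \<Rightarrow> int) \<Rightarrow> bool" where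
  "lin_char \<chi> \<longleftrightarrow> \<chi> = (\<lambda>p. 1) \<or> \<chi> = sign"

text \<open>The linear extension of \<open>\<chi>\<close> to the group ring. For a linear character
  it is multiplicative, so its kernel is a two-sided ideal, which can be intersected with the block
  of (2 1).\<close>

definition char_sum :: "nat \<Rightarrow> ((nat \<Rightarrow> nat) \<Rightarrow> int) \<Rightarrow>
    ((nat \<Rightarrow> nat) \<Rightarrow> 'k::field) \<Rightarrow> 'k" where
  "char_sum n \<chi> a = (\<Sum>p | p permutes {1..n}. of_int (\<chi> p) * a p)"

lemma lin_char_compose:
  assumes "lin_char \<chi>" "p permutes {1..n}" "q permutes {1..n}"
  shows "\<chi> (p \<circ> q) = \<chi> p * \<chi> q"
  using assms by (auto simp: lin_char_def intro!: sign_compose dest: permutes_imp_permutation[OF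
      finite_atLeastAtMost])

lemma char_sum_mult:
  fixes a b :: "(nat \<Rightarrow> nat) \<Rightarrow> 'k::field"
  assumes \<chi>: "lin_char \<chi>"
  shows "char_sum n \<chi> (a \<otimes>\<^bsub>group_ring n\<^esub> b) = char_sum n \<chi> a *
      char_sum n \<chi> b"
proof -
  let ?P = "{p. p permutes {1..n}}"
  have "char_sum n \<chi> (a \<otimes>\<^bsub>group_ring n\<^esub> b) = (\<Sum>s\<in>?P.
      \<Sum>p\<in>?P. of_int (\<chi> s) * (a p * b (Hilbert_Choice.inv p \<circ> s)))"
    unfolding char_sum_def by (intro sum.cong) (auto simp: group_ring_mult_apply sum_distrib_left)
  also have "\<dots> = (\<Sum>p\<in>?P. \<Sum>s\<in>?P. of_int (\<chi> s) * (a p * b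
      (Hilbert_Choice.inv p \<circ> s)))"
    by (rule sum.swap)
  also have "\<dots> = (\<Sum>p\<in>?P. \<Sum>q\<in>?P. (of_int (\<chi> p) * a p) * (of_int (\<chi>
      q) * b q))"
  proof (rule sum.cong[OF refl])
    fix p assume "p \<in> ?P"
    then have p: "p permutes {1..n}" by simp
    \<comment> \<open>Substituting \<open>p \<circ> q\<close> for \<open>s\<close> decouples the two
      sums, since \<open>\<chi>\<close> is multiplicative.\<close>
    have "(\<Sum>s\<in>?P. of_int (\<chi> s) * (a p * b (Hilbert_Choice.inv p \<circ> s)))
        = (\<Sum>q\<in>?P. of_int (\<chi> (p \<circ> q)) * (a p * b (Hilbert_Choice.inv p \<circ>
            (p \<circ> q))))"
      by (rule setum_permutations_compose_left[OF p])
    also have "\<dots> = (\<Sum>q\<in>?P. (of_int (\<chi> p) * a p) * (of_int (\<chi> q) * b q))"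
      using p by (intro sum.cong)
        (auto simp: lin_char_compose[OF \<chi>] comp_assoc[symmetric] permutes_inv_o mult_ac)
    finally show "(\<Sum>s\<in>?P. of_int (\<chi> s) * (a p * b (Hilbert_Choice.inv p \<circ> s)))
        = (\<Sum>q\<in>?P. (of_int (\<chi> p) * a p) * (of_int (\<chi> q) * b q))" .
  qed
  finally show ?thesis
    by (simp add: char_sum_def sum_product)
qed

lemma char_sum_ideal:
  fixes \<chi>
  assumes \<chi>: "lin_char \<chi>"
  shows "ideal {a \<in> carrier (group_ring n). char_sum n \<chi> a = (0::'k::field)} (group_ring n)"
proof -
  interpret ring "group_ring n :: ((nat \<Rightarrow> nat) \<Rightarrow> 'k) ring"
    by (rule group_ring_is_ring)
  have neg: "\<ominus>\<^bsub>group_ring n\<^esub> a = (\<lambda>s. - a s)" if "a \<in> carrier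
      (group_ring n)" for a :: "(nat \<Rightarrow> nat) \<Rightarrow> 'k"
    by (rule minus_equality) (use that in \<open>auto simp: group_ring_def\<close>)
  show ?thesis
  proof (rule idealI[OF ring_axioms])
    show "subgroup {a \<in> carrier (group_ring n). char_sum n \<chi> a = (0::'k)} (add_monoid
        (group_ring n))"
    proof (rule add.subgroupI)
      have "\<zero>\<^bsub>group_ring n\<^esub> \<in> {a \<in> carrier (group_ring n). char_sum n
          \<chi> a = (0::'k)}"
        by (auto simp: group_ring_def char_sum_def)
      then show "{a \<in> carrier (group_ring n). char_sum n \<chi> a = (0::'k)} \<noteq> {}" by blast
    next
      fix a :: "(nat \<Rightarrow> nat) \<Rightarrow> 'k"
      assume a: "a \<in> {a \<in> carrier (group_ring n). char_sum n \<chi> a = 0}"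
      then have "char_sum n \<chi> (\<lambda>s. - a s) = 0" by (simp add: char_sum_def sum_negf)
      then show "\<ominus>\<^bsub>group_ring n\<^esub> a \<in> {a \<in> carrier (group_ring n).
          char_sum n \<chi> a = 0}"
        using a neg[of a] a_inv_closed[of a] by simp
    next
      fix a b :: "(nat \<Rightarrow> nat) \<Rightarrow> 'k"
      assume "a \<in> {a \<in> carrier (group_ring n). char_sum n \<chi> a = 0}"
        and "b \<in> {a \<in> carrier (group_ring n). char_sum n \<chi> a = 0}"
      then show "a \<oplus>\<^bsub>group_ring n\<^esub> b \<in> {a \<in> carrier (group_ring n).
          char_sum n \<chi> a = 0}"
        by (auto simp: group_ring_def char_sum_def distrib_left sum.distrib)
    qed auto
  qed (auto simp: char_sum_mult[OF \<chi>])
qed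

text \<open>A permutation preserving two disjoint blocks is in a unique way a product of a
  permutation of each, namely of its restrictions extended by the identity. Row and column groups
  are stabilizers of this kind.\<close>

lemma sum_stabilizer:
  assumes "A \<inter> B = {}"
  shows "(\<Sum>p | p permutes (A \<union> B) \<and> p ` A = A \<and> p ` B = B. f p) =
    (\<Sum>p | p permutes A. \<Sum>q | q permutes B. f (p \<circ> q))"
proof -
  have "(\<Sum>p | p permutes (A \<union> B) \<and> p ` A = A \<and> p ` B = B. f p) =
      (\<Sum>(p, q) \<in> {p. p permutes A} \<times> {q. q permutes B}. f (p \<circ> q))"
  proof (rule sum.reindex_bij_witness[where i = "\<lambda>(p, q). p \<circ> q" and
        j = "\<lambda>p. (\<lambda>x. if x \<in> A then p x else x, \<lambda>x. if x \<in> B then p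
            x else x)"])
    fix p assume "p \<in> {p. p permutes (A \<union> B) \<and> p ` A = A \<and> p ` B = B}"
    then have p: "p permutes (A \<union> B)" "p ` A = A" "p ` B = B" by auto
    have "inj p" using p(1) by (rule permutes_inj)
    then have "bij_betw p A A" "bij_betw p B B"
      using p by (auto simp: bij_betw_def intro: inj_on_subset)
    then have "(\<lambda>x. if x \<in> A then p x else x) permutes A" "(\<lambda>x. if x \<in> B
        then p x else x) permutes B"
      by (auto intro!: bij_imp_permutes cong: bij_betw_cong)
    then show "(\<lambda>x. if x \<in> A then p x else x, \<lambda>x. if x \<in> B then p x else x)
        \<in> {p. p permutes A} \<times> {q. q permutes B}" by simp
    have "(\<lambda>x. if x \<in> A then p x else x) \<circ> (\<lambda>x. if x \<in> B then p x
        else x) = p"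
      using p assms permutes_not_in[OF p(1)] by (force simp: fun_eq_iff)
    then show "(case (\<lambda>x. if x \<in> A then p x else x, \<lambda>x. if x \<in> B then p x
        else x) of (p, q) \<Rightarrow> p \<circ> q) = p"
      and "(case (\<lambda>x. if x \<in> A then p x else x, \<lambda>x. if x \<in> B then p x else
          x) of (p, q) \<Rightarrow> f (p \<circ> q)) = f p"
      by simp_all
  next
    fix pq assume "pq \<in> {p. p permutes A} \<times> {q. q permutes B}"
    then obtain p q where pq: "pq = (p, q)" and p: "p permutes A" and q: "q permutes B" by auto
    have 1: "p (q x) = p x" if "x \<in> A" for x
      using permutes_not_in[OF q, of x] that assms by (metis disjoint_iff)
    have 2: "p (q x) = q x" if "x \<in> B" for x
      using that assms permutes_not_in[OF p, of "q x"] permutes_in_image[OF q, of x] by auto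
    have "(p \<circ> q) ` A = p ` A" "(p \<circ> q) ` B = q ` B"
      using 1 2 by (auto simp: image_iff)
    then show "(case pq of (p, q) \<Rightarrow> p \<circ> q) \<in> {p. p permutes (A \<union> B)
        \<and> p ` A = A \<and> p ` B = B}"
      using permutes_subset[OF p, of "A \<union> B"] permutes_subset[OF q, of "A \<union> B"]
      by (auto simp: pq permutes_image[OF p] permutes_image[OF q] intro!: permutes_compose)
    have "(\<lambda>x. if x \<in> A then (p \<circ> q) x else x) = p" "(\<lambda>x. if x \<in> B
        then (p \<circ> q) x else x) = q"
      using 1 2 permutes_not_in[OF p] permutes_not_in[OF q] by (auto simp: fun_eq_iff)
    then show "(\<lambda>x. if x \<in> A then (case pq of (p, q) \<Rightarrow> p \<circ> q) x else x,
        \<lambda>x. if x \<in> B then (case pq of (p, q) \<Rightarrow> p \<circ> q) x else x) = pq"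
      by (simp only: pq prod.case)
  qed
  then show ?thesis by (simp add: sum.cartesian_product)
qed

lemma sum_stabilizer_2:
  assumes "distinct [a, b, c, d]"
  shows "(\<Sum>p | p permutes {a, b, c, d} \<and> p ` {a, b} = {a, b} \<and> p ` {c, d} = {c, d}. f p) =
    f id + f (transpose a b) + f (transpose c d) + f (transpose a b \<circ> transpose c d)"
proof -
  have "{a, b, c, d} = {a, b} \<union> {c, d}" by auto
  moreover have "{a, b} \<inter> {c, d} = {}" using assms by auto
  ultimately show ?thesis
    using assms by (simp only: sum_stabilizer) (simp add: sum_permutes_2 add_ac)
qed

lemma sum_row_group_21:
  "(\<Sum>p\<in>row_group [[1, 2], [3]]. f p) = f id + f s12"
proof -
  have "row_group [[1, 2], [3::nat]] = {p. p permutes ({1, 2} \<union> {3}) \<and> p ` {1, 2} = {1,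
      2} \<and> p ` {3} = {3}}"
    by (auto simp: row_group_def insert_commute)
  then show ?thesis
    using sum_stabilizer[of "{1, 2::nat}" "{3}" f] by (simp add: sum_permutes_2 s12_def)
qed

text \<open>Column indices run over all naturals, but columns beyond the longest row are empty and
  impose no condition.\<close>

lemma all_column_iff:
  assumes "list_all (\<lambda>r. length r \<le> m) t"
  shows "(\<forall>j. p ` column t j = column t j) \<longleftrightarrow> (\<forall>j<m. p ` column
      t j = column t j)"
proof -
  have "column t j = {}" if "\<not> j < m" for j
    using that assms by (force simp: column_def list_all_length)
  then show ?thesis by (metis image_empty)
qed

lemma column_eq: "column t j = set (map (\<lambda>r. r ! j) (filter (\<lambda>r. j < length r) t))"
  by (auto simp: column_def in_set_conv_nth)

lemma sum_column_group_21:
  "(\<Sum>p\<in>column_group [[1, 2], [3]]. f p) = f id + f s13"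
proof -
  have "column_group [[1, 2], [3::nat]] = {p. p permutes ({1, 3} \<union> {2}) \<and> p ` {1, 3} =
      {1, 3} \<and> p ` {2} = {2}}"
    unfolding column_group_def
    by (subst all_column_iff[where m = 2])
      (auto simp: column_eq numeral_2_eq_2 All_less_Suc insert_commute)
  then show ?thesis
    using sum_stabilizer[of "{1, 3::nat}" "{2}" f] by (simp add: sum_permutes_2 s13_def)
qed

section \<open>Arithmetic in the group ring of S_3\<close>

lemma S3_distinct: "distinct [id, s13, s12, s13 \<circ> s12, s23, s13 \<circ> s23]"
proof -
  \<comment> \<open>A permutation of three letters is determined by its values at 1 and 2, so
    distinctness can be read off from concrete pairs.\<close>
  have "distinct (map (\<lambda>p. (p 1, p 2)) [id, s13, s12, s13 \<circ> s12, s23, s13 \<circ> s23])"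
    by (simp add: s12_def s13_def s23_def transpose_def)
  then show ?thesis unfolding distinct_map by blast
qed

lemma S3_sign:
  "sign s12 = -1" "sign s13 = -1" "sign s23 = -1" "sign (s13 \<circ> s12) = 1" "sign (s13 \<circ>
      s23) = 1"
  using permutes_S3[THEN permutes_imp_permutation[OF finite_atLeastAtMost]]
  by (simp_all add: sign_compose s12_def s13_def s23_def sign_swap_id)

text \<open>The rules of \<open>S3_compose\<close> with a trailing factor, so that they apply inside
  right-associated words.\<close>

lemma S3_compose3:
  "s13 \<circ> (s13 \<circ> f) = f" "s12 \<circ> (s12 \<circ> f) = f" "s23 \<circ> (s23 \<circ> f) = f"
  "s12 \<circ> (s13 \<circ> f) = s13 \<circ> (s23 \<circ> f)" "s23 \<circ> (s13 \<circ> f) = s13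
      \<circ> (s12 \<circ> f)"
  "s12 \<circ> (s23 \<circ> f) = s13 \<circ> (s12 \<circ> f)" "s23 \<circ> (s12 \<circ> f) = s13
      \<circ> (s23 \<circ> f)"
  using S3_compose by (metis comp_assoc id_comp)+

lemma S3_inv:
  "Hilbert_Choice.inv s12 = s12" "Hilbert_Choice.inv s13 = s13" "Hilbert_Choice.inv s23 = s23"
  "Hilbert_Choice.inv (s13 \<circ> s12) = s13 \<circ> s23" "Hilbert_Choice.inv (s13 \<circ> s23) =
      s13 \<circ> s12"
  by (rule inv_unique_comp; simp add: S3_compose S3_compose3 comp_assoc)+

text \<open>The two 3-cycles are inverse to each other, hence the crossed arguments in their terms;
  the transpositions are involutions.\<close>

lemma S3_mult:
  assumes "s permutes {1..3}"
  shows "(a \<otimes>\<^bsub>KS3\<^esub> b) s = a id * b s + a s13 * b (s13 \<circ> s) + a s12 * b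
      (s12 \<circ> s)
    + a (s13 \<circ> s12) * b (s13 \<circ> s23 \<circ> s) + a s23 * b (s23 \<circ> s) + a (s13
        \<circ> s23) * b (s13 \<circ> s12 \<circ> s)"
  unfolding group_ring_mult_apply[OF assms] sum_S3 S3_inv by simp

section \<open>The exceptional right ideal\<close>

lemma f0_values:
  "f0 id = (1 / 3 :: 'k::field_char_0)" "f0 s13 = (- (1 / 3) :: 'k)" "f0 s12 = (1 / 6 :: 'k)"
  "f0 (s13 \<circ> s12) = (- (1 / 6) :: 'k)" "f0 s23 = (1 / 6 :: 'k)" "f0 (s13 \<circ> s23) = (- (1
      / 6) :: 'k)"
  using S3_distinct unfolding f0_def sum_S3 S3_sign perm_elt_def s13_def[symmetric]
  by (auto)

lemma f0_carrier: "(f0 :: (nat \<Rightarrow> nat) \<Rightarrow> 'k::field_char_0) \<in> carrier KS3"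
proof -
  have "f0 s = (0 :: 'k)" if s: "\<not> s permutes {1..3}" for s
  proof -
    have "perm_elt p s = (0 :: 'k)" if "p permutes {1..3}" for p
      using s that by (auto simp: perm_elt_def)
    then show ?thesis
      by (simp add: f0_def permutes_id permutes_S3[unfolded s13_def] del: One_nat_def)
  qed
  then show ?thesis by (simp add: group_ring_def)
qed

text \<open>\<open>f0\<close> changes sign under left multiplication by \<open>s13\<close>, as its
  six values show, and every right multiple inherits this.\<close>

lemma r0_antisym:
  assumes "a \<in> (r0 :: ((nat \<Rightarrow> nat) \<Rightarrow> 'k::field_char_0) set)" "s
      permutes {1..3}"
  shows "a (s13 \<circ> s) = - a s"
proof -
  obtain x where a: "a = f0 \<otimes>\<^bsub>KS3\<^esub> x" using assms by (auto simp: r0_def)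
  show ?thesis
    using S3_cases[OF assms(2)]
    by cases (simp_all add: a S3_mult permutes_S3 permutes_id f0_values S3_compose S3_compose3 comp_assoc
        del: One_nat_def)
qed

section \<open>The block of (2 1)\<close>

lemma tableau_21: "tableau [2, 1] [[1, 2], [3]]"
  by (auto simp: tableau_def is_partition_def)

lemma young_symmetrizer_21:
  "young_symmetrizer [[1, 2], [3]] =
    (\<lambda>s. perm_elt id s + perm_elt s12 s - perm_elt s13 s - perm_elt (s13 \<circ> s23) s)"
  unfolding young_symmetrizer_def sum_row_group_21 sum_column_group_21
  by (simp add: S3_sign S3_compose fun_eq_iff)

lemma char_sum_perm_elt:
  "q permutes {1..n} \<Longrightarrow> char_sum n \<chi> (perm_elt q) = of_int (\<chi> q)"
  by (simp add: char_sum_def perm_elt_def finite_permutations if_distrib cong: if_cong del: One_nat_def)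

text \<open>The Young symmetrizer of one tableau of frame (2 1) is nonzero and is killed by both
  linear characters. So the kernel of \<open>char_sum 3 \<chi>\<close> meets the minimal ideal
  \<open>J\<close> in a nonzero ideal, which must be all of \<open>J\<close>.\<close>

lemma belongs_to_21_char_sum:
  fixes \<rr> :: "((nat \<Rightarrow> nat) \<Rightarrow> 'k::field) set"
  assumes "belongs_to \<rr> [2, 1]" and \<chi>: "lin_char \<chi>" and "a \<in> \<rr>"
  shows "char_sum 3 \<chi> a = 0"
proof -
  interpret ring "KS3 :: ((nat \<Rightarrow> nat) \<Rightarrow> 'k) ring"
    by (rule group_ring_is_ring)
  let ?y = "young_symmetrizer [[1, 2], [3]] :: (nat \<Rightarrow> nat) \<Rightarrow> 'k"
  let ?I = "{a \<in> carrier KS3. char_sum 3 \<chi> a = (0::'k)}"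
  obtain J where J: "minimal_ideal J KS3" "?y \<in> J" "\<rr> \<subseteq> J"
    using assms(1) tableau_21 by (auto simp: belongs_to_def)
  have ideal: "ideal J KS3" using J(1) by (simp add: minimal_ideal_def)
  have "?y \<in> carrier KS3"
    using J(2) ideal.Icarr[OF ideal] by blast
  moreover have "char_sum 3 \<chi> ?y = 0"
  proof -
    have "char_sum 3 \<chi> ?y = char_sum 3 \<chi> (perm_elt id) + char_sum 3 \<chi> (perm_elt s12)
        - char_sum 3 \<chi> (perm_elt s13) - char_sum 3 \<chi> (perm_elt (s13 \<circ> s23))"
      unfolding young_symmetrizer_21 char_sum_def distrib_left right_diff_distrib sum.distrib
          sum_subtractf ..
    also have "\<dots> = of_int (\<chi> id + \<chi> s12 - \<chi> s13 - \<chi> (s13 \<circ> s23))"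
      by (simp add: char_sum_perm_elt permutes_S3 permutes_id del: One_nat_def)
    also have "\<dots> = 0"
      using \<chi> by (auto simp: lin_char_def S3_sign)
    finally show ?thesis .
  qed
  ultimately have "?y \<in> J \<inter> ?I" using J(2) by blast
  moreover have "?y \<noteq> \<zero>\<^bsub>KS3\<^esub>"
  proof
    assume "?y = \<zero>\<^bsub>KS3\<^esub>"
    then have "?y id = 0" by (simp add: group_ring_def)
    moreover have "?y id = 1"
      using S3_distinct unfolding young_symmetrizer_21 perm_elt_def by simp
    ultimately show False by simp
  qed
  moreover have "ideal (J \<inter> ?I) KS3"
    using i_intersect[OF ideal char_sum_ideal[OF \<chi>]] .
  ultimately have "J \<inter> ?I = J"
    using J(1) unfolding minimal_ideal_def by blast
  then show ?thesis using J(3) assms(3) by blast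
qed

text \<open>The sum and the difference of the two characters isolate the even and the odd
  permutations, up to a factor 2 that is invertible in characteristic 0.\<close>

lemma S3_even_sum:
  fixes a :: "(nat \<Rightarrow> nat) \<Rightarrow> 'k::field_char_0"
  assumes "char_sum 3 (\<lambda>p. 1) a = 0" "char_sum 3 sign a = 0"
  shows "a id + a (s13 \<circ> s12) + a (s13 \<circ> s23) = 0" "a s13 + a s12 + a s23 = 0"
proof -
  have "2 * (a id + a (s13 \<circ> s12) + a (s13 \<circ> s23)) = char_sum 3 (\<lambda>p. 1) a +
      char_sum 3 sign a"
    unfolding char_sum_def sum_S3 S3_sign by simp
  then have "2 * (a id + a (s13 \<circ> s12) + a (s13 \<circ> s23)) = 0"
    unfolding assms by simp
  then show "a id + a (s13 \<circ> s12) + a (s13 \<circ> s23) = 0"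
    unfolding mult_eq_0_iff by simp
  have "2 * (a s13 + a s12 + a s23) = char_sum 3 (\<lambda>p. 1) a - char_sum 3 sign a"
    unfolding char_sum_def sum_S3 S3_sign by simp
  then have "2 * (a s13 + a s12 + a s23) = 0"
    unfolding assms by simp
  then show "a s13 + a s12 + a s23 = 0"
    unfolding mult_eq_0_iff by simp
qed

section \<open>Right ideals on which the functional vanishes\<close>

lemma right_ideal_translate:
  assumes "right_ideal \<rr> (group_ring n)" "a \<in> \<rr>" "u permutes {1..n}"
  shows "\<exists>a'\<in>\<rr>. \<forall>s. s permutes {1..n} \<longrightarrow> a' s = a (s \<circ> u)"
proof
  have a: "a \<in> carrier (group_ring n)"
    using assms(1,2) additive_subgroup.a_Hcarr by (auto simp: right_ideal_def)
  show "a \<otimes>\<^bsub>group_ring n\<^esub> perm_elt (Hilbert_Choice.inv u) \<in> \<rr>"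
    using assms by (auto simp: right_ideal_def permutes_inv perm_elt_carrier)
  show "\<forall>s. s permutes {1..n} \<longrightarrow>
      (a \<otimes>\<^bsub>group_ring n\<^esub> perm_elt (Hilbert_Choice.inv u)) s = a (s \<circ> u)"
    using group_ring_mult_perm_elt[OF a assms(3)] by blast
qed

text \<open>Consider the sums \<open>a s + a (s13 \<circ> s)\<close> over the three pairs. The
  hypothesis \<open>ker\<close> equates those of \<open>id\<close> and \<open>s12\<close>; its
  translate by \<open>s13\<close> equates those of \<open>id\<close> and \<open>s23\<close>. Their
  total is 0 by \<open>even\<close> and \<open>odd\<close>, so each is 0 because 3 is invertible.
  Translation by \<open>u\<close> carries this from \<open>id\<close> to \<open>u\<close>.\<close>

lemma right_ideal_antisym:
  fixes \<rr> :: "((nat \<Rightarrow> nat) \<Rightarrow> 'k::field_char_0) set"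
  assumes \<rr>: "right_ideal \<rr> KS3"
    and even: "\<And>a. a \<in> \<rr> \<Longrightarrow> a id + a (s13 \<circ> s12) + a (s13 \<circ>
        s23) = 0"
    and odd: "\<And>a. a \<in> \<rr> \<Longrightarrow> a s13 + a s12 + a s23 = 0"
    and ker: "\<And>a. a \<in> \<rr> \<Longrightarrow> a id + a s13 = a s12 + a (s13 \<circ> s12)"
    and a: "a \<in> \<rr>" and u: "u permutes {1..3}"
  shows "a (s13 \<circ> u) = - a u"
proof -
  have *: "a u + a (s13 \<circ> u) = a (s12 \<circ> u) + a (s13 \<circ> s12 \<circ> u)" if a: "a
      \<in> \<rr>" and u: "u permutes {1..3}" for a u
  proof -
    obtain a' where "a' \<in> \<rr>" "\<And>s. s permutes {1..3} \<Longrightarrow> a' s = a (s \<circ> u)"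
      using right_ideal_translate[OF \<rr> a u] by blast
    then show ?thesis
      using ker[of a'] permutes_S3 by (simp add: permutes_id del: One_nat_def)
  qed
  have id: "a s13 = - a id" if a: "a \<in> \<rr>" for a
  proof -
    have "a s23 + a (s13 \<circ> s23) = a id + a s13"
      using *[OF a permutes_S3(2)] by (simp add: S3_compose S3_compose3 comp_assoc add.commute)
    moreover have "(a id + a (s13 \<circ> s12) + a (s13 \<circ> s23)) + (a s13 + a s12 + a s23) =
        (a id + a s13) + (a s12 + a (s13 \<circ> s12)) + (a s23 + a (s13 \<circ> s23))"
      by (simp only: add_ac)
    ultimately have "3 * (a id + a s13) = 0"
      unfolding even[OF a] odd[OF a] ker[OF a, symmetric] by simp
    then show ?thesis
      unfolding mult_eq_0_iff by (simp add: eq_neg_iff_add_eq_0 add.commute)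
  qed
  obtain a' where "a' \<in> \<rr>" "\<And>s. s permutes {1..3} \<Longrightarrow> a' s = a (s \<circ> u)"
    using right_ideal_translate[OF \<rr> a u] by blast
  then show ?thesis
    using id[of a'] permutes_S3 by (simp add: permutes_id del: One_nat_def)
qed

text \<open>Antisymmetry and \<open>even\<close> make \<open>f0\<close> a left identity on
  \<open>\<rr>\<close>, which gives one inclusion. Conversely, from a nonzero element a right
  multiple equal to \<open>f0\<close> is produced.\<close>

lemma right_ideal_eq_r0:
  fixes \<rr> :: "((nat \<Rightarrow> nat) \<Rightarrow> 'k::field_char_0) set"
  assumes \<rr>: "right_ideal \<rr> KS3" "\<rr> \<noteq> {\<zero>\<^bsub>KS3\<^esub>}"
    and even: "\<And>a. a \<in> \<rr> \<Longrightarrow> a id + a (s13 \<circ> s12) + a (s13 \<circ>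
        s23) = 0"
    and antisym: "\<And>a u. a \<in> \<rr> \<Longrightarrow> u permutes {1..3} \<Longrightarrow> a
        (s13 \<circ> u) = - a u"
  shows "\<rr> = r0"
proof
  interpret ring "KS3 :: ((nat \<Rightarrow> nat) \<Rightarrow> 'k) ring"
    by (rule group_ring_is_ring)
  interpret additive_subgroup \<rr> KS3
    using \<rr>(1) by (simp add: right_ideal_def)
  \<comment> \<open>Only \<open>a s12\<close> and \<open>a s23\<close> remain free, so the products
    below reduce to field arithmetic.\<close>
  have coords: "a s13 = - a id" "a (s13 \<circ> s12) = - a s12" "a (s13 \<circ> s23) = - a s23"
    "a id = a s12 + a s23" if "a \<in> \<rr>" for a
    using antisym[OF that permutes_id] antisym[OF that permutes_S3(1)] antisym[OF that permutes_S3(3)]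
      even[OF that] by (simp_all add: algebra_simps)
  show "\<rr> \<subseteq> r0"
  proof
    fix a assume a: "a \<in> \<rr>"
    have "f0 \<otimes>\<^bsub>KS3\<^esub> a = a"
    proof
      fix s
      show "(f0 \<otimes>\<^bsub>KS3\<^esub> a) s = a s"
      proof (cases "s permutes {1..3}")
        case True
        then show ?thesis
          by (cases rule: S3_cases)
            (simp_all add: S3_mult permutes_S3 permutes_id f0_values S3_compose S3_compose3 comp_assoc
              coords(1-3)[OF a] coords(4)[OF a] field_simps del: One_nat_def)
      next
        case False
        then show ?thesis
          using a_Hcarr[OF a] by (simp add: group_ring_mult_outside) (simp add: group_ring_def)
      qed
    qed
    then show "a \<in> r0"
      using a_Hcarr[OF a] unfolding r0_def by force
  qed
  obtain b where b: "b \<in> \<rr>" "b \<noteq> \<zero>\<^bsub>KS3\<^esub>"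
    using \<rr>(2) zero_closed by blast
  then obtain u where "b u \<noteq> 0"
    by (auto simp: group_ring_def fun_eq_iff)
  then have u: "u permutes {1..3}"
    using a_Hcarr[OF b(1)] by (auto simp: group_ring_def)
  obtain a where a: "a \<in> \<rr>" and "\<And>s. s permutes {1..3} \<Longrightarrow> a s = b (s
      \<circ> u)"
    using right_ideal_translate[OF \<rr>(1) b(1) u] by blast
  then have a0: "a id \<noteq> 0" using \<open>b u \<noteq> 0\<close> by (simp add: permutes_id)
  \<comment> \<open>For such \<open>a\<close> the product of \<open>a\<close> and \<open>f0\<close>
    is \<open>3 * a id\<close> times \<open>f0\<close>. Dividing by this factor requires
    \<open>a id \<noteq> 0\<close>, which the translation by \<open>u\<close> has arranged.\<close>
  define c where "c = (\<lambda>s. f0 s / (3 * a id))"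
  have c: "c \<in> carrier KS3"
    using f0_carrier[where 'k = 'k] by (simp add: c_def group_ring_def)
  have f0: "a \<otimes>\<^bsub>KS3\<^esub> c = f0"
  proof
    fix s
    show "(a \<otimes>\<^bsub>KS3\<^esub> c) s = f0 s"
    proof (cases "s permutes {1..3}")
      case True
      then have "a id * f0 s + a s13 * f0 (s13 \<circ> s) + a s12 * f0 (s12 \<circ> s)
         + a (s13 \<circ> s12) * f0 (s13 \<circ> s23 \<circ> s) + a s23 * f0 (s23 \<circ> s) + a
             (s13 \<circ> s23) * f0 (s13 \<circ> s12 \<circ> s)
         = 3 * a id * f0 s"
        by (cases rule: S3_cases)
          (simp_all add: permutes_S3 permutes_id f0_values S3_compose S3_compose3 comp_assoc
            coords(1-3)[OF a] coords(4)[OF a] field_simps del: One_nat_def)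
      moreover have "(a \<otimes>\<^bsub>KS3\<^esub> c) s = (a id * f0 s + a s13 * f0 (s13 \<circ>
          s) + a s12 * f0 (s12 \<circ> s)
         + a (s13 \<circ> s12) * f0 (s13 \<circ> s23 \<circ> s) + a s23 * f0 (s23 \<circ> s) + a
             (s13 \<circ> s23) * f0 (s13 \<circ> s12 \<circ> s))
         / (3 * a id)"
        by (simp only: S3_mult[OF True] c_def add_divide_distrib times_divide_eq_right)
      ultimately have "(a \<otimes>\<^bsub>KS3\<^esub> c) s = 3 * a id * f0 s / (3 * a id)" by metis
      then show ?thesis using a0 by simp
    next
      case False
      then show ?thesis
        using f0_carrier[where 'k = 'k] by (simp add: group_ring_mult_outside) (simp add: group_ring_def)
    qed
  qed
  have mult: "a \<otimes>\<^bsub>KS3\<^esub> x \<in> \<rr>" if "a \<in> \<rr>" "x \<in> carrier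
      KS3" for a x
    using \<rr>(1) that unfolding right_ideal_def by blast
  have "f0 \<in> \<rr>" using mult[OF a c] unfolding f0 .
  then show "r0 \<subseteq> \<rr>"
    unfolding r0_def using mult by blast
qed

subsection \<open>Young symmetrization of curvature forms\<close>

text \<open>The signed sum over the column group of either tableau: the columns are {1,2} and {3,4},
  and in the larger tableau slot 5 is alone in its column.\<close>

definition alt_pairs :: "('v \<Rightarrow> 'v \<Rightarrow> 'v \<Rightarrow> 'v \<Rightarrow>
    'k::field) \<Rightarrow> 'v \<Rightarrow> 'v \<Rightarrow> 'v \<Rightarrow> 'v \<Rightarrow> 'k" where
  "alt_pairs F w x y z = F w x y z - F x w y z - F w x z y + F x w z y"

definition sym_rows4 :: "('v \<Rightarrow> 'v \<Rightarrow> 'v \<Rightarrow> 'v \<Rightarrow>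
    'k::field) \<Rightarrow> 'v \<Rightarrow> 'v \<Rightarrow> 'v \<Rightarrow> 'v \<Rightarrow> 'k" where
  "sym_rows4 F w x y z = F w x y z + F y x w z + F w z y x + F y z w x"

text \<open>Row symmetrization for the rows {1,3,5} and {2,4}, split by cosets of the smaller row
  group: the last slot receives argument 5, 3 or 1.\<close>

definition sym_rows5 ::
  "('v \<Rightarrow> 'v \<Rightarrow> 'v \<Rightarrow> 'v \<Rightarrow> 'v \<Rightarrow> 'k::field)
      \<Rightarrow> 'v \<Rightarrow> 'v \<Rightarrow> 'v \<Rightarrow> 'v \<Rightarrow> 'v
      \<Rightarrow> 'k" where
  "sym_rows5 F w x y z u =
     sym_rows4 (\<lambda>a b c d. F a b c d u) w x y z + sym_rows4 (\<lambda>a b c d. F a b c d y) w x u z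
     + sym_rows4 (\<lambda>a b c d. F a b c d w) u x y z"

definition curv_form :: "('v \<Rightarrow> 'v \<Rightarrow> 'v \<Rightarrow> 'v \<Rightarrow>
    'k::field) \<Rightarrow> bool" where
  "curv_form F \<longleftrightarrow> (\<forall>w x y z. F w x y z = - F w x z y \<and> F w x y z =
      F y z w x \<and>
     F w x y z + F w y z x + F w z x y = 0)"

text \<open>Exchanging both row pairs at once is the pair symmetry of \<open>F\<close>, so the four
  terms coincide two by two.\<close>

lemma curv_form_sym_rows:
  assumes "curv_form F"
  shows "sym_rows4 F w x y z = 2 * F w x y z + 2 * F y x w z"
  using assms unfolding curv_form_def sym_rows4_def by (smt (verit) mult_2 add.assoc add.commute
      add.left_commute)

lemma curv_form_alt_pairs1:
  assumes "curv_form F"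
  shows "alt_pairs F w x y z = 4 * F w x y z"
proof -
  have a: "F x w y z = - F w x y z" for w x y z
    using assms unfolding curv_form_def by metis
  have b: "F w x z y = - F w x y z" for w x y z
    using assms unfolding curv_form_def by metis
  show ?thesis unfolding alt_pairs_def a[of x w] b[of w x z y] by simp
qed

text \<open>The four terms are, up to sign, the two other terms of the first Bianchi identity, each
  occurring twice.\<close>

lemma curv_form_alt_pairs2:
  assumes "curv_form F"
  shows "alt_pairs (\<lambda>w x y z. F y x w z) w x y z = 2 * F w x y z"
proof -
  have "F y x w z = - F w z x y" "F y w x z = F w y z x"
    "F z x w y = F w y z x"  "F z w x y = - F w z x y"
    using assms unfolding curv_form_def by metis+
  moreover have "F w x y z = - F w y z x - F w z x y"
    using assms unfolding curv_form_def by (metis add.assoc add_eq_0_iff diff_minus_eq_add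
        minus_add_distrib uminus_add_conv_diff)
  ultimately show ?thesis unfolding alt_pairs_def by simp
qed

text \<open>The factor is 2 * 4 + 2 * 2, the hook product of the frame (2 2).\<close>

lemma curv_form_young:
  assumes "curv_form F"
  shows "alt_pairs (sym_rows4 F) w x y z = 12 * F w x y z"
proof -
  have "alt_pairs (sym_rows4 F) w x y z =
    2 * alt_pairs F w x y z + 2 * alt_pairs (\<lambda>w x y z. F y x w z) w x y z"
    unfolding alt_pairs_def curv_form_sym_rows[OF assms] by (simp add: algebra_simps)
  then show ?thesis by (simp add: curv_form_alt_pairs1[OF assms] curv_form_alt_pairs2[OF assms])
qed

section \<open>Covariant derivative curvature forms\<close>

definition deriv_curv_form :: "('v \<Rightarrow> 'v \<Rightarrow> 'v \<Rightarrow> 'v \<Rightarrow>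
    'v \<Rightarrow> 'k::field) \<Rightarrow> bool" where
  "deriv_curv_form F \<longleftrightarrow> (\<forall>u. curv_form (\<lambda>w x y z. F w x y z u)) \<and>
     (\<forall>w x y z u. F w x y z u + F w x z u y + F w x u y z = 0)"

text \<open>The hook product of (3 2) is 24. The coset with \<open>u\<close> in the last slot
  contributes 12 by \<open>curv_form_young\<close>; the other two cosets give four alternations,
  evaluated with both Bianchi identities.\<close>

lemma deriv_curv_form_young:
  assumes "deriv_curv_form F"
  shows "alt_pairs (\<lambda>w x y z. sym_rows5 F w x y z u) w x y z = 24 * F w x y z u"
proof -
  have c: "curv_form (\<lambda>w x y z. F w x y z u)" for u
    using assms by (simp add: deriv_curv_form_def)
  have B: "F w x y z u + F w x z u y + F w x u y z = 0" for w x y z u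
    using assms by (simp add: deriv_curv_form_def)
  have a: "F w x z y u = - F w x y z u" and p: "F y z w x u = F w x y z u"
    and b: "F w x y z u + F w y z x u + F w z x y u = 0" for w x y z u
    using c[of u] unfolding curv_form_def by metis+
  have a': "F x w y z u = - F w x y z u" for w x y z u
    by (metis a p)
  \<comment> \<open>\<open>b'\<close> is the first and \<open>B'\<close> the second Bianchi
    identity, each solved for a difference of two terms, the shape that alternation over a column
    produces.\<close>
  have b': "F u x w z y - F u w x z y = F w x u z y" for w x y z u
  proof -
    have e: "F u w x z y = - F u w z x y" "F w x u z y = - F u z x w y"
      by (metis a p)+
    show ?thesis
      using b[of u x w z y] unfolding e by (simp add: eq_neg_iff_add_eq_0)
  qed
  have B': "F w x u z y - F w x u y z = F w x y z u" for w x y z u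
  proof -
    have "F w x y z u = - (F w x z u y + F w x u y z)"
      using B[of w x y z u] by (metis add.assoc eq_neg_iff_add_eq_0)
    then show ?thesis by (simp add: a[of w x z u y])
  qed
  have 1: "alt_pairs (\<lambda>w x y z. F w x u z y) w x y z = 2 * F w x y z u"
    unfolding B'[of w x u z y, symmetric] alt_pairs_def a'[of x w] by (simp add: algebra_simps)
  have 2: "alt_pairs (\<lambda>w x y z. F u x w z y) w x y z = F w x y z u"
    using b'[of u x w z y] b'[of u x w y z] B'[of w x u z y]
    by (simp add: alt_pairs_def algebra_simps)
  have 3: "alt_pairs (\<lambda>w x y z. F u x y z w) w x y z = 2 * F w x y z u"
    unfolding alt_pairs_def a[of u x z y w] a[of u w z y x] p[of u x y z w] p[of u w y z x]
      p[of w x y z u] B'[of y z u x w, symmetric]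
    by simp
  \<comment> \<open>Pair symmetry brings the four terms into the shape of two instances of
    \<open>b'\<close>; their difference is then an instance of \<open>B'\<close>.\<close>
  have "F y x u z w - F y w u z x - F z x u y w + F z w u y x =
      (F u z y x w - F u y z x w) - (F u z y w x - F u y z w x)"
    unfolding p[of y x u z w] p[of y w u z x] p[of z x u y w] p[of z w u y x] by simp
  then have 4: "alt_pairs (\<lambda>w x y z. F y x u z w) w x y z = F w x y z u"
    by (simp only: alt_pairs_def b' B' p[of w x y z u])
  \<comment> \<open>The total is 12 + 2 * (2 + 1 + 2 + 1).\<close>
  have "alt_pairs (\<lambda>w x y z. sym_rows5 F w x y z u) w x y z =
     alt_pairs (sym_rows4 (\<lambda>w x y z. F w x y z u)) w x y z +
     2 * (alt_pairs (\<lambda>w x y z. F w x u z y) w x y z + alt_pairs (\<lambda>w x y z. F u x w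
         z y) w x y z +
       alt_pairs (\<lambda>w x y z. F u x y z w) w x y z + alt_pairs (\<lambda>w x y z. F y x u z
           w) w x y z)"
    unfolding alt_pairs_def sym_rows5_def curv_form_sym_rows[OF c] by (simp add: algebra_simps)
  then show ?thesis by (simp add: curv_form_young[OF c] 1 2 3 4)
qed

subsection \<open>The action of the Young symmetrizers on tensors\<close>

definition curry4 :: "((nat \<Rightarrow> 'v) \<Rightarrow> 'k) \<Rightarrow> 'v \<Rightarrow> 'v
    \<Rightarrow> 'v \<Rightarrow> 'v \<Rightarrow> 'k" where
  "curry4 T w x y z = T (tuple [w, x, y, z])"

definition curry5 :: "((nat \<Rightarrow> 'v) \<Rightarrow> 'k) \<Rightarrow> 'v \<Rightarrow> 'v
    \<Rightarrow> 'v \<Rightarrow> 'v \<Rightarrow> 'v \<Rightarrow> 'k" where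
  "curry5 T w x y z u = T (tuple [w, x, y, z, u])"

lemma curv_tensors_iff:
  "R \<in> curv_tensors scale \<longleftrightarrow> R \<in> tensors scale 4 \<and> curv_form (curry4 R)"
  unfolding curv_tensors_def curv_form_def curry4_def by (rule mem_Collect_eq)

lemma deriv_curv_tensors_iff:
  "R \<in> deriv_curv_tensors scale \<longleftrightarrow> R \<in> tensors scale 5 \<and>
      deriv_curv_form (curry5 R)"
  unfolding deriv_curv_tensors_def deriv_curv_form_def curv_form_def curry5_def mem_Collect_eq by blast

lemma tensors_cong:
  assumes "T \<in> tensors scale r" "\<And>i. i \<in> {1..r} \<Longrightarrow> v i = v' i"
  shows "T v = T v'"
  using assms unfolding tensors_def by blast

lemma tensors_eq_curry4:
  assumes "T \<in> tensors scale 4"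
  shows "T v = curry4 T (v 1) (v 2) (v 3) (v 4)"
  unfolding curry4_def
proof (rule tensors_cong[OF assms])
  fix i :: nat
  assume "i \<in> {1..4}"
  then have "i = 1 \<or> i = 2 \<or> i = 3 \<or> i = 4" by auto
  then show "v i = tuple [v 1, v 2, v 3, v 4] i"
    by (auto simp: tuple_def)
qed

lemma tensors_eq_curry5:
  assumes "T \<in> tensors scale 5"
  shows "T v = curry5 T (v 1) (v 2) (v 3) (v 4) (v 5)"
  unfolding curry5_def
proof (rule tensors_cong[OF assms])
  fix i :: nat
  assume "i \<in> {1..5}"
  then have "i = 1 \<or> i = 2 \<or> i = 3 \<or> i = 4 \<or> i = 5" by auto
  then show "v i = tuple [v 1, v 2, v 3, v 4, v 5] i"
    by (auto simp: tuple_def)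
qed

lemma tuple_nth:
  "tuple (x # xs) (Suc 0) = x" "0 < n \<Longrightarrow> tuple (x # xs) (Suc n) = tuple xs n"
  "tuple (x # xs) 1 = x" "tuple (x # y # xs) 2 = y" "tuple (x # y # z # xs) 3 = z"
  "tuple (x # y # z # u # xs) 4 = u" "tuple (x # y # z # u # w # xs) 5 = w"
  by (simp_all add: tuple_def nth_Cons split: nat.split)

text \<open>The star turns \<open>p \<circ> q\<close> into the product of inverses in reversed
  order. Both groups are closed under inversion and the sign is invariant, so the starred
  symmetrizer first sums over rows and then takes the signed sum over columns.\<close>

lemma gr_act_young_star:
  fixes T :: "(nat \<Rightarrow> 'v) \<Rightarrow> 'k::field"
  assumes t: "set (concat t) = {1..n}"
  shows "gr_act n (gr_star n (young_symmetrizer t)) T v =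
    (\<Sum>q\<in>column_group t. of_int (sign q) * (\<Sum>p\<in>row_group t. T (\<lambda>i. v (q (p
        i)))))"
proof -
  let ?P = "{p. p permutes {1..n}}"
  have inv_image: "Hilbert_Choice.inv p ` A = A" if "p permutes B" "p ` A = A" for p :: "nat
      \<Rightarrow> nat" and A B
    using image_inv_f_f[OF permutes_inj[OF that(1)], of A] that(2) by simp
  have row: "row_group t \<subseteq> ?P" and col: "column_group t \<subseteq> ?P"
    unfolding row_group_def column_group_def t by blast+
  have row_inv: "Hilbert_Choice.inv p \<in> row_group t" if "p \<in> row_group t" for p
  proof -
    have p: "p permutes {1..n}" "\<forall>row\<in>set t. p ` set row = set row"
      using that unfolding row_group_def t by simp_all
    then show ?thesis
      unfolding row_group_def t by (simp add: permutes_inv inv_image[OF p(1)] del: One_nat_def)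
  qed
  have col_inv: "Hilbert_Choice.inv p \<in> column_group t" if "p \<in> column_group t" for p
  proof -
    have p: "p permutes {1..n}" "\<forall>j. p ` column t j = column t j"
      using that unfolding column_group_def t by simp_all
    then show ?thesis
      unfolding column_group_def t by (simp add: permutes_inv inv_image[OF p(1)] del: One_nat_def)
  qed
  have star: "gr_star n a s = a (Hilbert_Choice.inv s)" if s: "s permutes {1..n}" for a :: "(nat
      \<Rightarrow> nat) \<Rightarrow> 'k" and s
  proof -
    have "gr_star n a s = (\<Sum>p\<in>?P. if p = Hilbert_Choice.inv s then a p else 0)"
      unfolding gr_star_def
      by (intro sum.cong) (auto simp: perm_elt_def permutes_inv_inv permutes_inv_inv[OF s])
    then show ?thesis
      using permutes_inv[OF s] by (simp add: finite_permutations)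
  qed
  have delta: "(\<Sum>s\<in>?P. c * perm_elt r s * g s) = c * g r" if "r permutes {1..n}" for r c
      and g :: "_ \<Rightarrow> 'k"
  proof -
    have "(\<Sum>s\<in>?P. c * perm_elt r s * g s) = (\<Sum>s\<in>?P. if s = r then c * g s else 0)"
      by (rule sum.cong) (simp_all add: perm_elt_def)
    then show ?thesis using that by (simp add: finite_permutations)
  qed
  have "gr_act n (gr_star n (young_symmetrizer t)) T v =
      (\<Sum>s\<in>?P. young_symmetrizer t (Hilbert_Choice.inv s) * T (\<lambda>i. v (s i)))"
    unfolding gr_act_def by (rule sum.cong[OF refl]) (simp only: star mem_Collect_eq)
  \<comment> \<open>Reindexing by inversion moves the star from the coefficients to the arguments of
    \<open>T\<close>.\<close>
  also have "\<dots> = (\<Sum>s\<in>?P. young_symmetrizer t s * T (\<lambda>i. v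
      (Hilbert_Choice.inv s i)))"
    by (subst sum_permutations_inverse, rule sum.cong[OF refl]) (simp only: permutes_inv_inv
        mem_Collect_eq)
  also have "\<dots> = (\<Sum>s\<in>?P. \<Sum>p\<in>row_group t. \<Sum>q\<in>column_group t.
      of_int (sign q) * perm_elt (p \<circ> q) s * T (\<lambda>i. v (Hilbert_Choice.inv s i)))"
    by (simp only: young_symmetrizer_def sum_distrib_right)
  also have "\<dots> = (\<Sum>p\<in>row_group t. \<Sum>q\<in>column_group t. \<Sum>s\<in>?P.
      of_int (sign q) * perm_elt (p \<circ> q) s * T (\<lambda>i. v (Hilbert_Choice.inv s i)))"
    by (subst sum.swap) (rule sum.cong[OF refl], rule sum.swap)
  also have "\<dots> = (\<Sum>p\<in>row_group t. \<Sum>q\<in>column_group t.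
      of_int (sign (Hilbert_Choice.inv q)) * T (\<lambda>i. v (Hilbert_Choice.inv q
          (Hilbert_Choice.inv p i))))"
  proof (rule sum.cong[OF refl], rule sum.cong[OF refl])
    fix p q assume "p \<in> row_group t" "q \<in> column_group t"
    then have p: "p permutes {1..n}" and q: "q permutes {1..n}" using row col by auto
    have "Hilbert_Choice.inv (p \<circ> q) = Hilbert_Choice.inv q \<circ> Hilbert_Choice.inv p"
      using p q by (simp add: o_inv_distrib permutes_bij)
    moreover have "sign (Hilbert_Choice.inv q) = sign q"
      using permutes_imp_permutation[OF finite_atLeastAtMost q] by (rule sign_inverse)
    ultimately show "(\<Sum>s\<in>?P. of_int (sign q) * perm_elt (p \<circ> q) s * T (\<lambda>i. v
        (Hilbert_Choice.inv s i))) =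
        of_int (sign (Hilbert_Choice.inv q)) * T (\<lambda>i. v (Hilbert_Choice.inv q
            (Hilbert_Choice.inv p i)))"
      unfolding delta[OF permutes_compose[OF q p]] by simp
  qed
  also have "\<dots> = (\<Sum>p\<in>row_group t. \<Sum>q\<in>column_group t. of_int (sign q) * T
      (\<lambda>i. v (q (p i))))"
  proof -
    \<comment> \<open>The sign has been written as that of the inverse, so each summand depends on
      \<open>p\<close> and \<open>q\<close> only through their inverses and inversion is a
      reindexing.\<close>
    have bij: "bij_betw Hilbert_Choice.inv G G"
      if G: "G \<subseteq> ?P" "\<And>p. p \<in> G \<Longrightarrow> Hilbert_Choice.inv p \<in> G" for G
    proof (rule bij_betw_byWitness)
      show "\<forall>p\<in>G. Hilbert_Choice.inv (Hilbert_Choice.inv p) = p"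
        using G(1) permutes_inv_inv by blast
      then show "\<forall>p\<in>G. Hilbert_Choice.inv (Hilbert_Choice.inv p) = p" .
      show "Hilbert_Choice.inv ` G \<subseteq> G"
        using G(2) by (rule image_subsetI)
      then show "Hilbert_Choice.inv ` G \<subseteq> G" .
    qed
    have "(\<Sum>q\<in>column_group t. of_int (sign (Hilbert_Choice.inv q)) * T (\<lambda>i. v
        (Hilbert_Choice.inv q (Hilbert_Choice.inv p i))))
        = (\<Sum>q\<in>column_group t. of_int (sign q) * T (\<lambda>i. v (q (Hilbert_Choice.inv p
            i))))" for p
      by (rule sum.reindex_bij_betw[OF bij[OF col col_inv],
            of "\<lambda>q. of_int (sign q) * T (\<lambda>i. v (q (Hilbert_Choice.inv p i)))"])
    then show ?thesis
      using sum.reindex_bij_betw[OF bij[OF row row_inv],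
          of "\<lambda>p. \<Sum>q\<in>column_group t. of_int (sign q) * T (\<lambda>i. v (q (p i)))"]
      by (simp only:)
  qed
  also have "\<dots> = (\<Sum>q\<in>column_group t. \<Sum>p\<in>row_group t. of_int (sign q) * T
      (\<lambda>i. v (q (p i))))"
    by (rule sum.swap)
  finally show ?thesis by (simp only: sum_distrib_left)
qed

section \<open>Row and column groups of the two tableaux\<close>

lemma sum_row_group_22:
  "(\<Sum>p\<in>row_group [[1, 3], [2, 4]]. f p) =
    f id + f (transpose 1 3) + f (transpose 2 4) + f (transpose 1 3 \<circ> transpose 2 4)"
proof -
  have "row_group [[1, 3], [2, 4::nat]] = {p. p permutes {1, 3, 2, 4} \<and> p ` {1, 3} = {1, 3}
      \<and> p ` {2, 4} = {2, 4}}"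
    by (auto simp: row_group_def)
  then show ?thesis using sum_stabilizer_2[of 1 3 2 4 f] by simp
qed

lemma sum_row_group_32:
  fixes f :: "(nat \<Rightarrow> nat) \<Rightarrow> 'a::comm_monoid_add"
  shows "(\<Sum>p\<in>row_group [[1, 3, 5], [2, 4]]. f p) =
    f id + f (transpose 2 4) + (f (transpose 1 3) + f (transpose 1 3 \<circ> transpose 2 4))
    + (f (transpose 1 5) + f (transpose 1 5 \<circ> transpose 2 4))
    + (f (transpose 3 5) + f (transpose 3 5 \<circ> transpose 2 4))
    + (f (transpose 1 3 \<circ> transpose 3 5) + f (transpose 1 3 \<circ> transpose 3 5 \<circ>
        transpose 2 4))
    + (f (transpose 1 5 \<circ> transpose 3 5) + f (transpose 1 5 \<circ> transpose 3 5 \<circ>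
        transpose 2 4))"
proof -
  have rows: "row_group [[1, 3, 5], [2, 4::nat]] =
      {p. p permutes ({1, 3, 5} \<union> {2, 4}) \<and> p ` {1, 3, 5} = {1, 3, 5} \<and> p ` {2, 4}
          = {2, 4}}"
    by (auto simp: row_group_def insert_commute)
  have disj: "{1, 3, 5} \<inter> {2, 4::nat} = {}" by simp
  have 2: "(\<Sum>q | q permutes {2, 4::nat}. g q) = g id + g (transpose 2 4)" for g :: "_
      \<Rightarrow> 'a"
    by (rule sum_permutes_2) simp
  have 3: "(\<Sum>p | p permutes {1, 3, 5::nat}. g p) =
      g id + g (transpose 1 3) + g (transpose 1 5) + g (transpose 3 5)
      + g (transpose 1 3 \<circ> transpose 3 5) + g (transpose 1 5 \<circ> transpose 3 5)" for g ::
          "_ \<Rightarrow> 'a"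
    by (rule sum_permutes_3) simp_all
  show ?thesis
    unfolding rows sum_stabilizer[OF disj] 2 3 by simp
qed

lemma All_less_2: "(\<forall>j<2. P j) \<longleftrightarrow> P 0 \<and> P (1::nat)"
  by (auto simp: less_Suc_eq numeral_2_eq_2)

lemma All_less_3: "(\<forall>j<3. P j) \<longleftrightarrow> P 0 \<and> P 1 \<and> P (2::nat)"
  by (auto simp: less_Suc_eq numeral_3_eq_3 numeral_2_eq_2)

lemma sum_column_group_22:
  "(\<Sum>p\<in>column_group [[1, 3], [2, 4]]. f p) =
    f id + f (transpose 1 2) + f (transpose 3 4) + f (transpose 1 2 \<circ> transpose 3 4)"
proof -
  let ?t = "[[1, 3], [2, 4::nat]]"
  have cols: "column ?t 0 = {1, 2}" "column ?t 1 = {3, 4}"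
    by (simp_all add: column_eq)
  have "(\<forall>j. p ` column ?t j = column ?t j) \<longleftrightarrow> p ` {1, 2} = {1, 2}
      \<and> p ` {3, 4} = {3, 4}" for p
    by (subst all_column_iff[where m = 2]) (simp_all only: cols All_less_2, simp)
  moreover have "set (concat ?t) = {1, 2, 3, 4}" by auto
  ultimately have "column_group ?t = {p. p permutes {1, 2, 3, 4} \<and> p ` {1, 2} = {1, 2} \<and>
      p ` {3, 4} = {3, 4}}"
    by (simp only: column_group_def)
  then show ?thesis using sum_stabilizer_2[of 1 2 3 4 f] by simp
qed

text \<open>The third column is the singleton {5}, so 5 is fixed and the column group is that of the
  2 by 2 tableau.\<close>

lemma sum_column_group_32:
  "(\<Sum>p\<in>column_group [[1, 3, 5], [2, 4]]. f p) =
    f id + f (transpose 1 2) + f (transpose 3 4) + f (transpose 1 2 \<circ> transpose 3 4)"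
proof -
  let ?t = "[[1, 3, 5], [2, 4::nat]]"
  have cols: "column ?t 0 = {1, 2}" "column ?t 1 = {3, 4}" "column ?t 2 = {5}"
    by (simp_all add: column_eq)
  have fix5: "p permutes {1, 2, 3, 4, 5} \<and> p 5 = 5 \<longleftrightarrow> p permutes {1, 2, 3,
      4}" for p :: "nat \<Rightarrow> nat"
  proof
    assume "p permutes {1, 2, 3, 4, 5} \<and> p 5 = 5"
    then show "p permutes {1, 2, 3, 4}"
      by (elim conjE permutes_superset) auto
  next
    assume p: "p permutes {1, 2, 3, 4}"
    then have "p permutes {1, 2, 3, 4, 5}" by (rule permutes_subset) auto
    moreover have "p 5 = 5" using p by (rule permutes_not_in) simp
    ultimately show "p permutes {1, 2, 3, 4, 5} \<and> p 5 = 5" ..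
  qed
  have "(\<forall>j. p ` column ?t j = column ?t j) \<longleftrightarrow> p ` {1, 2} = {1, 2}
      \<and> p ` {3, 4} = {3, 4} \<and> p ` {5} = {5}" for p
    by (subst all_column_iff[where m = 3]) (simp_all only: cols All_less_3, simp)
  moreover have "p ` {5} = {5} \<longleftrightarrow> p 5 = 5" for p :: "nat \<Rightarrow> nat" by simp
  moreover have "set (concat ?t) = {1, 2, 3, 4, 5}" by auto
  ultimately have "column_group ?t = {p. p permutes {1, 2, 3, 4, 5} \<and> p ` {1, 2} = {1, 2}
      \<and> p ` {3, 4} = {3, 4} \<and> p 5 = 5}"
    by (simp only: column_group_def)
  also have "\<dots> = {p. p permutes {1, 2, 3, 4} \<and> p ` {1, 2} = {1, 2} \<and> p ` {3, 4} = {3, 4}}"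
    unfolding fix5[symmetric] by (rule Collect_cong) blast
  finally show ?thesis using sum_stabilizer_2[of 1 2 3 4 f] by simp
qed

section \<open>The symmetrizers on curried tensors\<close>

abbreviation (input) young4 :: "((nat \<Rightarrow> 'v) \<Rightarrow> 'k) \<Rightarrow> (nat
    \<Rightarrow> 'v) \<Rightarrow> 'k::field" where
  "young4 \<equiv> gr_act 4 (gr_star 4 (young_symmetrizer [[1, 3], [2, 4]]))"

abbreviation (input) young5 :: "((nat \<Rightarrow> 'v) \<Rightarrow> 'k) \<Rightarrow> (nat
    \<Rightarrow> 'v) \<Rightarrow> 'k::field" where
  "young5 \<equiv> gr_act 5 (gr_star 5 (young_symmetrizer [[1, 3, 5], [2, 4]]))"

lemma sum_rows_22:
  assumes "T \<in> tensors scale 4"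
  shows "(\<Sum>p\<in>row_group [[1, 3], [2, 4]]. T (\<lambda>i. v (p i))) = sym_rows4 (curry4 T)
      (v 1) (v 2) (v 3) (v 4)"
  unfolding sum_row_group_22 sym_rows4_def id_apply comp_apply
  by (simp only: tensors_eq_curry4[OF assms] transpose_def) simp

lemma sum_rows_32:
  assumes "T \<in> tensors scale 5"
  shows "(\<Sum>p\<in>row_group [[1, 3, 5], [2, 4]]. T (\<lambda>i. v (p i))) =
    sym_rows5 (curry5 T) (v 1) (v 2) (v 3) (v 4) (v 5)"
  unfolding sum_row_group_32 sym_rows4_def sym_rows5_def id_apply comp_apply
  by (simp only: tensors_eq_curry5[OF assms] transpose_def) (simp add: add_ac)

lemma sign_column_22: "sign (transpose 1 2 \<circ> transpose 3 (4::nat)) = 1"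
  by (subst sign_compose) (simp_all add: sign_swap_id permutation_swap_id)

lemma young4_eq:
  assumes "T \<in> tensors scale 4"
  shows "young4 T v = alt_pairs (sym_rows4 (curry4 T)) (v 1) (v 2) (v 3) (v 4)"
proof -
  have set: "set (concat [[1, 3], [2, 4]]) = {1..4::nat}" by auto
  show ?thesis
    unfolding gr_act_young_star[OF set] sum_rows_22[OF assms, of "\<lambda>i. v (q i)" for q]
      sum_column_group_22 sign_column_22 alt_pairs_def
    by (simp add: sign_swap_id transpose_def)
qed

lemma young5_eq:
  assumes "T \<in> tensors scale 5"
  shows "young5 T v = alt_pairs (\<lambda>w x y z. sym_rows5 (curry5 T) w x y z (v 5)) (v 1) (v 2)
      (v 3) (v 4)"
proof -
  have set: "set (concat [[1, 3, 5], [2, 4]]) = {1..5::nat}" by auto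
  show ?thesis
    unfolding gr_act_young_star[OF set] sum_rows_32[OF assms, of "\<lambda>i. v (q i)" for q]
      sum_column_group_32 sign_column_22 alt_pairs_def
    by (simp add: sign_swap_id transpose_def)
qed

text \<open>The two row transpositions \<open>S\<close> suffice: after expanding the alternation,
  the terms of each curvature identity cancel in pairs.\<close>

lemma alt_sym_rows4_curv_form: "curv_form (alt_pairs (sym_rows4 F))"
proof -
  have S: "sym_rows4 F y x w z = sym_rows4 F w x y z" "sym_rows4 F w z y x = sym_rows4 F w x y z"
      for w x y z
    by (simp_all add: sym_rows4_def)
  show ?thesis
    unfolding curv_form_def alt_pairs_def by (simp add: S algebra_simps)
qed

text \<open>As before; the symmetry in slots 3 and 5 also cancels the terms of the second Bianchi
  identity in pairs.\<close>

lemma alt_sym_rows5_deriv_curv_form: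
  "deriv_curv_form (\<lambda>w x y z u. alt_pairs (\<lambda>w x y z. sym_rows5 F w x y z u) w x y z)"
proof -
  have S: "sym_rows5 F y x w z u = sym_rows5 F w x y z u" "sym_rows5 F w z y x u = sym_rows5 F w x y z u"
    "sym_rows5 F w x u z y = sym_rows5 F w x y z u" "sym_rows5 F u x y z w = sym_rows5 F w x y z u"
        for w x y z u
    by (simp_all add: sym_rows5_def sym_rows4_def)
  show ?thesis
    unfolding deriv_curv_form_def curv_form_def alt_pairs_def by (simp add: S algebra_simps)
qed

text \<open>This is the origin of the functional \<open>c\<close>. Row symmetrization ignores the
  exchange of slots 1 and 3, and antisymmetry of \<open>F\<close> turns the terms of
  \<open>c\<close> and \<open>d\<close> into negatives of the first two. In the terms of
  \<open>e\<close> and \<open>f\<close> the antisymmetric slots hold \<open>w\<close> and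
  \<open>y\<close>, which lie in one row, so these terms vanish.\<close>

lemma sym_rows4_S3:
  assumes "\<And>w x y z. F x w y z = - F w x y z"
  shows "sym_rows4 (\<lambda>w x y z. a * F w x y z + b * F y x w z + c * F x w y z + d * F x y w z
      + e * F w y x z + f * F y w x z) w x y z = (a + b - c - d) * sym_rows4 F w x y z"
  unfolding sym_rows4_def assms[of x w] assms[of y w] assms[of z w] assms[of y x] assms[of z x]
      assms[of z y]
  by (simp add: algebra_simps)

lemma sym_rows5_S3:
  assumes "\<And>w x y z u. F x w y z u = - F w x y z u"
  shows "sym_rows5 (\<lambda>w x y z u. a * F w x y z u + b * F y x w z u + c * F x w y z u + d * F
      x y w z u
      + e * F w y x z u + f * F y w x z u) w x y z u = (a + b - c - d) * sym_rows5 F w x y z u"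
  unfolding sym_rows5_def sym_rows4_S3[of "\<lambda>w x y z. F w x y z t" for t, OF assms] by (simp
      add: algebra_simps)

text \<open>In each term one antisymmetric pair of slots of \<open>F\<close> is filled by two of
  \<open>w\<close>, \<open>y\<close>, \<open>u\<close>. These lie in one row, so the symmetrization
  cancels the term.\<close>

lemma sym_rows5_swap:
  assumes A: "\<And>w x y z u. F x w y z u = - F w x y z u" and B: "\<And>w x y z u. F w x z y u =
      - F w x y z u"
  shows "sym_rows5 (\<lambda>w x y z u. a * F w x y u z + b * F y x w u z + c * F x w y u z + d * F
      x y w u z
      + e * F w y x u z + f * F y w x u z) w x y z u = 0"
  unfolding sym_rows5_def sym_rows4_def
    A[of x w] A[of y w] A[of z w] A[of u w] A[of y x] A[of z x] A[of u x] A[of z y] A[of u y] A[of u z]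
    B[of _ _ x w] B[of _ _ y w] B[of _ _ z w] B[of _ _ u w] B[of _ _ y x] B[of _ _ z x] B[of _ _ u x]
    B[of _ _ z y] B[of _ _ u y] B[of _ _ u z]
  by (simp add: algebra_simps)

text \<open>Slots 1 and 3 share a row, so the summands cancel in pairs.\<close>

lemma sym_rows4_antisym_eq_0:
  assumes "\<And>w x y z. F y x w z = - F w x y z"
  shows "sym_rows4 F w x y z = 0"
  unfolding sym_rows4_def assms[of y x w z] assms[of y z w x] by simp

lemma sym_rows5_antisym_eq_0:
  assumes "\<And>w x y z u. F y x w z u = - F w x y z u"
  shows "sym_rows5 F w x y z u = 0"
  unfolding sym_rows5_def sym_rows4_antisym_eq_0[of "\<lambda>w x y z. F w x y z t" for t, OF
      assms] by simp

section \<open>Multilinearity and spans of tensors\<close>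

lemma vector_space_field: "vector_space ((*) :: 'k::field \<Rightarrow> 'k \<Rightarrow> 'k)"
  by unfold_locales (simp_all add: algebra_simps)

lemma tensors_iff:
  fixes scale :: "'k::field \<Rightarrow> 'v::ab_group_add \<Rightarrow> 'v"
  assumes "vector_space scale"
  shows "T \<in> tensors scale r \<longleftrightarrow> (\<forall>v v'. (\<forall>i\<in>{1..r}. v i
      = v' i) \<longrightarrow> T v = T v') \<and>
    (\<forall>i\<in>{1..r}. \<forall>v x y. T (v(i := x + y)) = T (v(i := x)) + T (v(i := y))) \<and>
    (\<forall>i\<in>{1..r}. \<forall>v c x. T (v(i := scale c x)) = c * T (v(i := x)))"
  unfolding tensors_def Vector_Spaces.linear_iff using assms vector_space_field by blast

lemma tensors_lincomb:
  assumes V: "vector_space scale" and T: "\<And>k. k \<in> K \<Longrightarrow> T k \<in> tensors scale r"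
  shows "(\<lambda>v. \<Sum>k\<in>K. c k * T k v) \<in> tensors scale r"
proof -
  have *: "\<And>v v'. (\<forall>i\<in>{1..r}. v i = v' i) \<Longrightarrow> T k v = T k v'"
    "\<And>i v x y. i \<in> {1..r} \<Longrightarrow> T k (v(i := x + y)) = T k (v(i := x)) + T k
        (v(i := y))"
    "\<And>i v d x. i \<in> {1..r} \<Longrightarrow> T k (v(i := scale d x)) = d * T k (v(i := x))"
        if "k \<in> K" for k
    using T[OF that] unfolding tensors_iff[OF V] by blast+
  show ?thesis
    unfolding tensors_iff[OF V]
  proof (intro conjI allI impI ballI)
    show "(\<Sum>k\<in>K. c k * T k v) = (\<Sum>k\<in>K. c k * T k v')" if "\<forall>i\<in>{1..r}.
        v i = v' i" for v v'
      by (rule sum.cong) (simp_all only: *(1)[OF _ that])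
    show "(\<Sum>k\<in>K. c k * T k (v(i := x + y))) = (\<Sum>k\<in>K. c k * T k (v(i := x))) +
        (\<Sum>k\<in>K. c k * T k (v(i := y)))"
      if "i \<in> {1..r}" for i v x y
      unfolding sum.distrib[symmetric] by (rule sum.cong) (simp_all only: *(2)[OF _ that] distrib_left)
    show "(\<Sum>k\<in>K. c k * T k (v(i := scale d x))) = d * (\<Sum>k\<in>K. c k * T k (v(i := x)))"
      if "i \<in> {1..r}" for i v d x
      unfolding sum_distrib_left by (rule sum.cong) (simp_all only: *(3)[OF _ that] mult.left_commute)
  qed
qed

lemma tensors_permute:
  assumes V: "vector_space scale" and p: "p permutes {1..r}" and T: "T \<in> tensors scale r"
  shows "(\<lambda>v. T (\<lambda>i. v (p i))) \<in> tensors scale r"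
proof -
  have upd: "(\<lambda>j. (v(i := x)) (p j)) = (\<lambda>j. v (p j))(Hilbert_Choice.inv p i := x)"
      for v i x
    using permutes_inverses[OF p] by (auto simp: fun_eq_iff)
  have inv: "Hilbert_Choice.inv p i \<in> {1..r}" if "i \<in> {1..r}" for i
    using permutes_in_image[OF permutes_inv[OF p]] that by blast
  have cong: "T (\<lambda>i. v (p i)) = T (\<lambda>i. v' (p i))" if "\<forall>i\<in>{1..r}. v i =
      v' i" for v v'
    using that permutes_in_image[OF p] by (intro tensors_cong[OF T]) blast
  have T': "T (v(i := x + y)) = T (v(i := x)) + T (v(i := y))" "T (v(i := scale c x)) = c * T (v(i := x))"
    if "i \<in> {1..r}" for i v x y c
    using T that unfolding tensors_iff[OF V] by blast+
  show ?thesis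
    unfolding tensors_iff[OF V] upd
    by (intro conjI allI impI ballI) (rule cong T'(1)[OF inv] T'(2)[OF inv]; assumption)+
qed

lemma gr_act_tensors:
  assumes V: "vector_space scale" and T: "T \<in> tensors scale r"
  shows "gr_act r a T \<in> tensors scale r"
  unfolding gr_act_def by (rule tensors_lincomb[OF V]) (use tensors_permute[OF V _ T] in blast)

lemma tensor_prod_tensors:
  fixes scale :: "'k::field \<Rightarrow> 'v::ab_group_add \<Rightarrow> 'v"
  assumes V: "vector_space scale" and T: "T \<in> tensors scale r" and S: "S \<in> tensors scale m"
  shows "tensor_prod r T S \<in> tensors scale (r + m)"
proof -
  have T1: "T (v(i := x)) = T v" if "i \<notin> {1..r}" for i v x
    by (rule tensors_cong[OF T]) (use that in auto)
  have S1: "S (\<lambda>j. (v(i := x)) (r + j)) = S (\<lambda>j. v (r + j))" if "i \<in> {1..r}" for i v x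
    by (rule tensors_cong[OF S]) (use that in auto)
  have S2: "(\<lambda>j. (v(i := x)) (r + j)) = (\<lambda>j. v (r + j))(i - r := x)" if "i \<in>
      {r+1..r+m}"
    for i x and v :: "nat \<Rightarrow> 'v"
    using that by (auto simp: fun_eq_iff)
  have T': "T (v(i := x + y)) = T (v(i := x)) + T (v(i := y))" "T (v(i := scale c x)) = c * T (v(i := x))"
    if "i \<in> {1..r}" for i v x y c
    using T that unfolding tensors_iff[OF V] by blast+
  have S': "S (v(i := x + y)) = S (v(i := x)) + S (v(i := y))" "S (v(i := scale c x)) = c * S (v(i := x))"
    if "i \<in> {1..m}" for i v x y c
    using S that unfolding tensors_iff[OF V] by blast+
  have split: "i \<in> {1..r} \<or> i \<notin> {1..r} \<and> i \<in> {r+1..r+m} \<and> i - r \<in>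
      {1..m}" if "i \<in> {1..r+m}" for i
    using that by auto
  show ?thesis
    unfolding tensors_iff[OF V] tensor_prod_def
  proof (intro conjI allI impI ballI)
    fix v v' :: "nat \<Rightarrow> 'v" assume eq: "\<forall>i\<in>{1..r+m}. v i = v' i"
    have "T v = T v'" by (rule tensors_cong[OF T]) (use eq in auto)
    moreover have "S (\<lambda>i. v (r + i)) = S (\<lambda>i. v' (r + i))" by (rule tensors_cong[OF
        S]) (use eq in auto)
    ultimately show "T v * S (\<lambda>i. v (r + i)) = T v' * S (\<lambda>i. v' (r + i))" by simp
  next
    fix i and v :: "nat \<Rightarrow> 'v" and x y assume "i \<in> {1..r+m}"
    from split[OF this] show "T (v(i := x + y)) * S (\<lambda>j. (v(i := x + y)) (r + j)) =
        T (v(i := x)) * S (\<lambda>j. (v(i := x)) (r + j)) + T (v(i := y)) * S (\<lambda>j. (v(i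
            := y)) (r + j))"
      by (elim disjE conjE) (simp_all only: T1 S1 S2 T' S' distrib_left distrib_right not_False_eq_True)
  next
    fix i and v :: "nat \<Rightarrow> 'v" and c x assume "i \<in> {1..r+m}"
    from split[OF this] show "T (v(i := scale c x)) * S (\<lambda>j. (v(i := scale c x)) (r + j)) =
        c * (T (v(i := x)) * S (\<lambda>j. (v(i := x)) (r + j)))"
      by (elim disjE conjE) (simp_all only: T1 S1 S2 T' S' mult_ac not_False_eq_True)
  qed
qed

text \<open>Permutations of the first \<open>r\<close> slots fix the later ones. Thus S_3 acts on
  tensors of order 4 and 5 through their first three slots, compatibly with the symmetry
  class.\<close>

lemma gr_act_tensor_prod:
  assumes "S \<in> tensors scale m"
  shows "gr_act r a (tensor_prod r T S) = tensor_prod r (gr_act r a T) S"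
proof
  fix v
  have "S (\<lambda>i. v (p (r + i))) = S (\<lambda>i. v (r + i))" if "p permutes {1..r}" for p
    by (rule tensors_cong[OF assms]) (use permutes_not_in[OF that] in auto)
  then show "gr_act r a (tensor_prod r T S) v = tensor_prod r (gr_act r a T) S v"
    by (simp add: gr_act_def tensor_prod_def sum_distrib_right mult.assoc)
qed

lemma gr_act_lincomb:
  "gr_act n a (\<lambda>v. \<Sum>k\<in>K. c k * T k v) = (\<lambda>v. \<Sum>k\<in>K. c k * gr_act n
      a (T k) v)"
  unfolding gr_act_def sum_distrib_left by (subst sum.swap) (simp add: mult_ac)

lemma module_fun: "module (\<lambda>(c :: 'k::field) (T :: 'a \<Rightarrow> 'k) v. c * T v)"
  by unfold_locales (simp_all add: fun_eq_iff algebra_simps)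

lemma tensor_span_lincomb:
  assumes "\<And>k. k \<in> K \<Longrightarrow> T k \<in> tensor_span X"
  shows "(\<lambda>v. \<Sum>k\<in>K. c k * T k v) \<in> tensor_span X"
proof -
  have "(\<Sum>k\<in>K. (\<lambda>v. c k * T k v)) \<in> tensor_span X"
    using assms module.span_scale[OF module_fun] unfolding tensor_span_def
    by (intro module.span_sum[OF module_fun]) blast
  moreover have "(\<Sum>k\<in>K. (\<lambda>v. c k * T k v)) = (\<lambda>v. \<Sum>k\<in>K. c k * T k v)"
    by (rule ext) (induction K rule: infinite_finite_induct, auto)
  ultimately show ?thesis by simp
qed

text \<open>The image of the whole tensor space under a group ring element is already a subspace, so
  spans of symmetrized products stay inside it.\<close>

lemma tensor_span_gr_act_subset:
  assumes V: "vector_space scale" and X: "X \<subseteq> gr_act n y ` tensors scale n"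
  shows "tensor_span X \<subseteq> gr_act n y ` tensors scale n"
  unfolding tensor_span_def
proof (rule module.span_minimal[OF module_fun X])
  \<comment> \<open>A combination of two tensors is treated as a sum over the booleans, so that the
    results on finite sums apply.\<close>
  have lin: "(\<lambda>v. c * T v + d * S v) \<in> tensors scale n"
      "gr_act n y (\<lambda>v. c * T v + d * S v) = (\<lambda>v. c * gr_act n y T v + d * gr_act n y S v)"
    if "T \<in> tensors scale n" "S \<in> tensors scale n" for T S c d
    using tensors_lincomb[OF V, where K = UNIV and T = "\<lambda>b. if b then T else S" and r = n
          and c = "\<lambda>b. if b then c else d"]
      gr_act_lincomb[where n = n and a = y and K = UNIV and T = "\<lambda>b. if b then T else S"
          and c = "\<lambda>b. if b then c else d"] that
    by (simp_all add: UNIV_bool add.commute)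
  have zero: "(\<lambda>v. 0) \<in> tensors scale n" "gr_act n y (\<lambda>v. 0) = (\<lambda>v. 0)"
    using tensors_lincomb[OF V, where K = "{}"] by (simp_all add: gr_act_def)
  show "module.subspace (\<lambda>c T v. c * T v) (gr_act n y ` tensors scale n)"
    unfolding module.subspace_def[OF module_fun]
  proof (intro conjI ballI allI)
    show "0 \<in> gr_act n y ` tensors scale n"
      unfolding zero_fun_def by (rule image_eqI[where x = "\<lambda>v. 0"]) (simp_all only: zero)
    fix f g assume "f \<in> gr_act n y ` tensors scale n" "g \<in> gr_act n y ` tensors scale n"
    then obtain T S where "f = gr_act n y T" "g = gr_act n y S" "T \<in> tensors scale n" "S \<in>
        tensors scale n"
      by blast
    then show "f + g \<in> gr_act n y ` tensors scale n"
      using lin[of T S 1 1] by (auto simp: plus_fun_def image_iff intro!: bexI[of _ "\<lambda>v. T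
          v + S v"])
  next
    fix f c assume "f \<in> gr_act n y ` tensors scale n"
    then obtain T where "f = gr_act n y T" "T \<in> tensors scale n" by blast
    then show "(\<lambda>v. c * f v) \<in> gr_act n y ` tensors scale n"
      using lin[of T T c 0] by (auto simp: image_iff intro!: bexI[of _ "\<lambda>v. c * T v"])
  qed
qed

lemma curv_tensors_young4:
  fixes scale :: "'k::field \<Rightarrow> 'v::ab_group_add \<Rightarrow> 'v"
  assumes V: "vector_space scale"
  shows "young4 ` tensors scale 4 \<subseteq> curv_tensors scale"
proof (rule image_subsetI)
  fix T :: "(nat \<Rightarrow> 'v) \<Rightarrow> 'k" assume T: "T \<in> tensors scale 4"
  have "curry4 (young4 T) = alt_pairs (sym_rows4 (curry4 T))"
    by (intro ext) (simp only: curry4_def[of "young4 T"] young4_eq[OF T] tuple_nth)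
  then show "young4 T \<in> curv_tensors scale"
    by (simp add: curv_tensors_iff gr_act_tensors[OF V T] alt_sym_rows4_curv_form)
qed

lemma deriv_curv_tensors_young5:
  fixes scale :: "'k::field \<Rightarrow> 'v::ab_group_add \<Rightarrow> 'v"
  assumes V: "vector_space scale"
  shows "young5 ` tensors scale 5 \<subseteq> deriv_curv_tensors scale"
proof (rule image_subsetI)
  fix T :: "(nat \<Rightarrow> 'v) \<Rightarrow> 'k" assume T: "T \<in> tensors scale 5"
  have "curry5 (young5 T) = (\<lambda>w x y z u. alt_pairs (\<lambda>w x y z. sym_rows5 (curry5 T)
      w x y z u) w x y z)"
    by (intro ext) (simp only: curry5_def[of "young5 T"] young5_eq[OF T] tuple_nth)
  then show "young5 T \<in> deriv_curv_tensors scale"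
    by (simp add: deriv_curv_tensors_iff gr_act_tensors[OF V T] alt_sym_rows5_deriv_curv_form)
qed

section \<open>Products with a symmetry class\<close>

definition class_prods ::
  "('k::field \<Rightarrow> 'v::ab_group_add \<Rightarrow> 'v) \<Rightarrow> ((nat \<Rightarrow>
      nat) \<Rightarrow> 'k) set \<Rightarrow> ((nat \<Rightarrow> 'v) \<Rightarrow> 'k) set
      \<Rightarrow> ((nat \<Rightarrow> 'v) \<Rightarrow> 'k) set" where
  "class_prods scale \<rr> Q = {tensor_prod 3 U S | U S. U \<in> symmetry_class scale 3 \<rr>
      \<and> S \<in> Q}"

lemma class_prods_image:
  "{gr_act n y (tensor_prod 3 U S) | U S. U \<in> symmetry_class scale 3 \<rr> \<and> S \<in> Q} =
    gr_act n y ` class_prods scale \<rr> Q"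
  unfolding class_prods_def by blast

lemma class_prods_tensors:
  assumes V: "vector_space scale" and Q: "Q \<subseteq> tensors scale m"
  shows "class_prods scale \<rr> Q \<subseteq> tensors scale (3 + m)"
  using Q tensor_prod_tensors[OF V] gr_act_tensors[OF V]
  unfolding class_prods_def symmetry_class_def by blast

text \<open>The factors \<open>U k\<close> need not lie in the symmetry class: applying
  \<open>a\<close> to \<open>T\<close> replaces each by \<open>gr_act 3 a (U k)\<close>, which does.
  Any splitting of a tensor after slot 3 can therefore be used.\<close>

lemma tensor_span_class_prods:
  assumes Q: "Q \<subseteq> tensors scale m" and "a \<in> \<rr>"
    and T: "\<And>v. T v = (\<Sum>k\<in>K. tensor_prod 3 (U k) (S k) v)"
    and U: "\<And>k. k \<in> K \<Longrightarrow> U k \<in> tensors scale 3" and S: "\<And>k. k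
        \<in> K \<Longrightarrow> S k \<in> Q"
  shows "gr_act n y (gr_act 3 a T) \<in> tensor_span (gr_act n y ` class_prods scale \<rr> Q)"
proof -
  have "gr_act 3 a (tensor_prod 3 (U k) (S k)) \<in> class_prods scale \<rr> Q" if "k \<in> K" for k
  proof -
    have "S k \<in> tensors scale m" using S Q that by blast
    then have "gr_act 3 a (tensor_prod 3 (U k) (S k)) = tensor_prod 3 (gr_act 3 a (U k)) (S k)"
      by (rule gr_act_tensor_prod)
    then show ?thesis
      using \<open>a \<in> \<rr>\<close> U[OF that] S[OF that] unfolding class_prods_def
          symmetry_class_def by blast
  qed
  then have "(\<lambda>v. \<Sum>k\<in>K. 1 * gr_act n y (gr_act 3 a (tensor_prod 3 (U k) (S k))) v)
      \<in> tensor_span (gr_act n y ` class_prods scale \<rr> Q)"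
    by (intro tensor_span_lincomb) (simp add: tensor_span_def module.span_base[OF module_fun])
  moreover have "T = (\<lambda>v. \<Sum>k\<in>K. 1 * tensor_prod 3 (U k) (S k) v)"
    using T by (simp add: fun_eq_iff)
  ultimately show ?thesis
    by (simp only: gr_act_lincomb)
qed

section \<open>The multiples of a curvature tensor\<close>

lemma S3_eval:
  "s12 1 = 2" "s12 2 = 1" "s12 3 = 3" "s13 1 = 3" "s13 2 = 2" "s13 3 = 1" "s23 1 = 1" "s23 2 = 3"
      "s23 3 = 2"
  "s12 4 = 4" "s12 5 = 5" "s13 4 = 4" "s13 5 = 5" "s23 4 = 4" "s23 5 = 5"
  by (simp_all add: s12_def s13_def s23_def transpose_def)

lemma gr_act3_curry4:
  assumes T: "T \<in> tensors scale 4"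
  shows "curry4 (gr_act 3 a T) = (\<lambda>w x y z. a id * curry4 T w x y z + a s13 * curry4 T y x w z
    + a s12 * curry4 T x w y z + a (s13 \<circ> s12) * curry4 T x y w z
    + a s23 * curry4 T w y x z + a (s13 \<circ> s23) * curry4 T y w x z)"
  by (intro ext, subst curry4_def) (simp only: gr_act_def sum_S3 tensors_eq_curry4[OF T]
      id_apply comp_apply S3_eval tuple_nth)

lemma gr_act3_curry5:
  assumes T: "T \<in> tensors scale 5"
  shows "curry5 (gr_act 3 a T) = (\<lambda>w x y z u. a id * curry5 T w x y z u + a s13 * curry5 T
      y x w z u
    + a s12 * curry5 T x w y z u + a (s13 \<circ> s12) * curry5 T x y w z u
    + a s23 * curry5 T w y x z u + a (s13 \<circ> s23) * curry5 T y w x z u)"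
  by (intro ext, subst curry5_def) (simp only: gr_act_def sum_S3 tensors_eq_curry5[OF T]
      id_apply comp_apply S3_eval tuple_nth)

lemma gr_act3_tensors:
  assumes V: "vector_space scale" and "3 \<le> n" and T: "T \<in> tensors scale n"
  shows "gr_act 3 a T \<in> tensors scale n"
  unfolding gr_act_def
proof (rule tensors_lincomb[OF V])
  fix p :: "nat \<Rightarrow> nat" assume "p \<in> {p. p permutes {1..3}}"
  then have "p permutes {1..n}" using permutes_subset[of p "{1..3}" "{1..n}"] \<open>3 \<le>
      n\<close> by auto
  then show "(\<lambda>v. T (\<lambda>i. v (p i))) \<in> tensors scale n" by (rule
      tensors_permute[OF V _ T])
qed

definition kernel_form :: "((nat \<Rightarrow> nat) \<Rightarrow> 'k::field) \<Rightarrow> 'k" where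
  "kernel_form a = a id + a s13 - a s12 - a (s13 \<circ> s12)"

lemma curv_form_antisym1:
  assumes "curv_form F"
  shows "F x w y z = - F w x y z"
  using assms unfolding curv_form_def by metis

lemma young4_curv_tensor:
  assumes V: "vector_space scale" and R: "R \<in> curv_tensors scale"
  shows "young4 (gr_act 3 a R) = (\<lambda>v. 12 * kernel_form a * R v)"
proof
  fix v
  have T: "R \<in> tensors scale 4" and c: "curv_form (curry4 R)" using R by (simp_all add:
      curv_tensors_iff)
  have T': "gr_act 3 a R \<in> tensors scale 4" by (rule gr_act3_tensors[OF V _ T]) simp
  have "young4 (gr_act 3 a R) v = kernel_form a * alt_pairs (sym_rows4 (curry4 R)) (v 1) (v 2) (v
      3) (v 4)"
    unfolding young4_eq[OF T'] gr_act3_curry4[OF T] alt_pairs_def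
      sym_rows4_S3[of "curry4 R", OF curv_form_antisym1[OF c]] kernel_form_def
    by (simp add: algebra_simps)
  then show "young4 (gr_act 3 a R) v = 12 * kernel_form a * R v"
    unfolding curv_form_young[OF c] tensors_eq_curry4[OF T, of v] by simp
qed

text \<open>For \<open>e\<close> equal to 1 or -1 this is twice the symmetrization or alternation in
  the last two slots. It leaves the first three slots alone, where S_3 acts.\<close>

definition swap45 :: "'k::field \<Rightarrow> ((nat \<Rightarrow> 'v) \<Rightarrow> 'k)
    \<Rightarrow> (nat \<Rightarrow> 'v) \<Rightarrow> 'k" where
  "swap45 e T v = T v + e * T (\<lambda>i. v (transpose 4 5 i))"

lemma swap45_tensors:
  assumes V: "vector_space scale" and T: "T \<in> tensors scale 5"
  shows "swap45 e T \<in> tensors scale 5"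
proof -
  have "(\<lambda>v. T (\<lambda>i. v (transpose 4 5 i))) \<in> tensors scale 5"
    by (rule tensors_permute[OF V permutes_swap_id T]) auto
  then have "(\<lambda>v. \<Sum>b\<in>UNIV. (if b then 1 else e) * (if b then T else (\<lambda>v. T
      (\<lambda>i. v (transpose 4 5 i)))) v)
      \<in> tensors scale 5"
    using T by (intro tensors_lincomb[OF V]) auto
  then show ?thesis
    by (simp add: UNIV_bool swap45_def[abs_def] add.commute)
qed

lemma young5_deriv_curv_tensor:
  assumes V: "vector_space scale" and R: "R \<in> deriv_curv_tensors scale"
  shows "young5 (gr_act 3 a (swap45 e R)) = (\<lambda>v. 24 * kernel_form a * R v)"
proof
  fix v
  have T: "R \<in> tensors scale 5" and c: "deriv_curv_form (curry5 R)" using R by (simp_all add: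
      deriv_curv_tensors_iff)
  note T' = swap45_tensors[OF V T, of e]
  have c': "curv_form (\<lambda>w x y z. curry5 R w x y z u)" for u
    using c by (simp add: deriv_curv_form_def)
  have A: "curry5 R x w y z u = - curry5 R w x y z u" for w x y z u
    by (rule curv_form_antisym1[OF c'])
  have B: "curry5 R w x z y u = - curry5 R w x y z u" for w x y z u
    using c'[of u] unfolding curv_form_def by metis
  have swap: "curry5 (swap45 e R) = (\<lambda>w x y z u. curry5 R w x y z u + e * curry5 R w x y u z)"
    by (intro ext) (simp add: curry5_def[of "swap45 e R"] swap45_def tensors_eq_curry5[OF T]
        tuple_nth transpose_def)
  have sym: "sym_rows5 (curry5 (gr_act 3 a (swap45 e R))) w x y z u = kernel_form a * sym_rows5
      (curry5 R) w x y z u" for w x y z u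
  proof -
    let ?F = "curry5 R"
    \<comment> \<open>The part without exchange yields \<open>kernel_form a\<close>; the part with
      slots 4 and 5 exchanged is annihilated, so the result does not depend on
      \<open>e\<close>.\<close>
    have "sym_rows5 (curry5 (gr_act 3 a (swap45 e R))) w x y z u =
      sym_rows5 (\<lambda>w x y z u. a id * ?F w x y z u + a s13 * ?F y x w z u + a s12 * ?F x w y z u
        + a (s13 \<circ> s12) * ?F x y w z u + a s23 * ?F w y x z u + a (s13 \<circ> s23) * ?F y w
            x z u) w x y z u
      + e * sym_rows5 (\<lambda>w x y z u. a id * ?F w x y u z + a s13 * ?F y x w u z + a s12 * ?F
          x w y u z
        + a (s13 \<circ> s12) * ?F x y w u z + a s23 * ?F w y x u z + a (s13 \<circ> s23) * ?F y w
            x u z) w x y z u"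
      unfolding gr_act3_curry5[OF T'] swap by (simp add: sym_rows5_def sym_rows4_def algebra_simps)
    then show ?thesis
      unfolding sym_rows5_S3[of ?F, OF A] sym_rows5_swap[of ?F, OF A B] kernel_form_def by simp
  qed
  have T'': "gr_act 3 a (swap45 e R) \<in> tensors scale 5" by (rule gr_act3_tensors[OF V _ T']) simp
  have "young5 (gr_act 3 a (swap45 e R)) v =
      kernel_form a * alt_pairs (\<lambda>w x y z. sym_rows5 (curry5 R) w x y z (v 5)) (v 1) (v 2)
          (v 3) (v 4)"
    unfolding young5_eq[OF T''] alt_pairs_def sym by (simp add: algebra_simps)
  then show "young5 (gr_act 3 a (swap45 e R)) v = 24 * kernel_form a * R v"
    unfolding deriv_curv_form_young[OF c] tensors_eq_curry5[OF T, of v] by simp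
qed

section \<open>Bases and frozen slots\<close>

lemma tensors_expand:
  assumes "finite_dimensional_vector_space scale Basis" and T: "T \<in> tensors scale n" and i: "i
      \<in> {1..n}"
  shows "T v = (\<Sum>b\<in>Basis. module.representation scale Basis (v i) b * T (v(i := b)))"
proof -
  interpret finite_dimensional_vector_space scale Basis by fact
  have lin: "Vector_Spaces.linear scale (*) (\<lambda>x. T (v(i := x)))"
    using T i unfolding tensors_def by blast
  interpret f: module_hom scale "(*)" "\<lambda>x. T (v(i := x))"
    using lin by (simp add: linear_iff_module_hom)
  have "v i = (\<Sum>b\<in>Basis. scale (representation Basis (v i) b) b)"
    using sum_representation_eq[OF independent_Basis _ finite_Basis order_refl, of "v i"] by (simp
        add: span_Basis)
  then have "T (v(i := v i)) = T (v(i := (\<Sum>b\<in>Basis. scale (representation Basis (v i) b) b)))"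
    by (rule arg_cong)
  then show ?thesis by (simp add: f.sum f.scale)
qed

definition coord :: "('k::field \<Rightarrow> 'v::ab_group_add \<Rightarrow> 'v) \<Rightarrow> 'v
    set \<Rightarrow> 'v \<Rightarrow> 'v \<Rightarrow> 'k" where
  "coord scale Basis b x = module.representation scale Basis x b"

lemma coord_linear:
  assumes "finite_dimensional_vector_space scale Basis"
  shows "coord scale Basis b (x + y) = coord scale Basis b x + coord scale Basis b y"
    "coord scale Basis b (scale c x) = c * coord scale Basis b x"
proof -
  interpret finite_dimensional_vector_space scale Basis by fact
  show "coord scale Basis b (x + y) = coord scale Basis b x + coord scale Basis b y"
    unfolding coord_def using representation_add[OF independent_Basis, of y x] by (simp add: span_Basis)
  show "coord scale Basis b (scale c x) = c * coord scale Basis b x"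
    unfolding coord_def using representation_scale[OF independent_Basis, of x c] by (simp add: span_Basis)
qed

lemma coord_Basis:
  assumes "finite_dimensional_vector_space scale Basis" and "b \<in> Basis"
  shows "coord scale Basis b' b = (if b' = b then 1 else 0)"
proof -
  interpret finite_dimensional_vector_space scale Basis by fact
  show ?thesis
    unfolding coord_def using representation_basis[OF independent_Basis \<open>b \<in>
        Basis\<close>] by auto
qed

text \<open>\<open>g\<close> copies the first \<open>m\<close> slots and freezes all others to
  values independent of \<open>v\<close>.\<close>

lemma tensors_restrict:
  assumes V: "vector_space scale" and T: "T \<in> tensors scale n" and m: "m \<le> n"
    and v: "\<And>v i. i \<in> {1..m} \<Longrightarrow> g v i = v i" "\<And>v v' i. i \<notin>
        {1..m} \<Longrightarrow> g v i = g v' i"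
  shows "(\<lambda>v. T (g v)) \<in> tensors scale m"
proof -
  have upd: "g (v(i := x)) = (g v)(i := x)" if "i \<in> {1..m}" for v i x
  proof
    fix j show "g (v(i := x)) j = ((g v)(i := x)) j"
      using v(1)[of j] v(2)[of j] that by (cases "j \<in> {1..m}") auto
  qed
  have cong: "T (g v) = T (g v')" if "\<forall>i\<in>{1..m}. v i = v' i" for v v'
  proof -
    have "g v i = g v' i" for i
      using v(1)[of i] v(2)[of i] that by (cases "i \<in> {1..m}") auto
    then have "g v = g v'" by (rule ext)
    then show ?thesis by simp
  qed
  have T': "T (v(i := x + y)) = T (v(i := x)) + T (v(i := y))" "T (v(i := scale c x)) = c * T (v(i := x))"
    if "i \<in> {1..m}" for i v x y c
  proof -
    have "i \<in> {1..n}" using that m by auto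
    then show "T (v(i := x + y)) = T (v(i := x)) + T (v(i := y))" "T (v(i := scale c x)) = c * T
        (v(i := x))"
      using T unfolding tensors_iff[OF V] by blast+
  qed
  show ?thesis
    unfolding tensors_iff[OF V]
    by (intro conjI allI impI ballI) (erule cong, (simp only: upd T')+)
qed

lemma coord_tensors1:
  assumes V: "finite_dimensional_vector_space scale Basis"
  shows "(\<lambda>v. coord scale Basis b (v 1)) \<in> tensors scale 1"
proof -
  interpret finite_dimensional_vector_space scale Basis by fact
  show ?thesis
    unfolding tensors_iff[OF vector_space_axioms] by (auto simp: coord_linear[OF V])
qed

text \<open>The values 1 and -1 of \<open>e\<close> give the symmetric and the alternating forms, so
  both cases share one proof.\<close>

definition swap_forms :: "('k::field \<Rightarrow> 'v::ab_group_add \<Rightarrow> 'v) \<Rightarrow>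
    'k \<Rightarrow> ((nat \<Rightarrow> 'v) \<Rightarrow> 'k) set" where
  "swap_forms scale e = {S \<in> tensors scale 2. \<forall>x y. S (tuple [x, y]) = e * S (tuple [y, x])}"

text \<open>Exchanging the arguments exchanges the two summands up to a factor \<open>e\<close>,
  which is compensated by \<open>e * e = 1\<close>.\<close>

lemma coord_swap_forms:
  assumes V: "finite_dimensional_vector_space scale Basis" and e: "e * e = 1"
  shows "(\<lambda>v. coord scale Basis b (v 1) * coord scale Basis b' (v 2)
      + e * (coord scale Basis b (v 2) * coord scale Basis b' (v 1))) \<in> swap_forms scale e"
proof -
  interpret finite_dimensional_vector_space scale Basis by fact
  have 12: "i \<in> {1..2} \<longleftrightarrow> i = 1 \<or> i = 2" for i :: nat by auto
  have "e * (e * x) = x" for x using e by (simp flip: mult.assoc)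
  then show ?thesis
    unfolding swap_forms_def mem_Collect_eq tensors_iff[OF vector_space_axioms] 12
    by (auto simp: coord_linear[OF V] tuple_nth algebra_simps)
qed

subsection \<open>Spanning\<close>

text \<open>Positions 0 and above 5 also receive \<open>b'\<close>; this is harmless, as tensors of
  order at most 5 do not read them. For order 4 only \<open>b\<close> matters.\<close>

definition fix45 :: "'v \<Rightarrow> 'v \<Rightarrow> (nat \<Rightarrow> 'v) \<Rightarrow> nat
    \<Rightarrow> 'v" where
  "fix45 b b' v i = (if i \<in> {1..3} then v i else if i = 4 then b else b')"

lemma fix45_tensors:
  assumes "vector_space scale" "T \<in> tensors scale n" "3 \<le> n"
  shows "(\<lambda>v. T (fix45 b b' v)) \<in> tensors scale 3"
  using assms by (rule tensors_restrict) (auto simp: fix45_def)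

text \<open>Expanding slot 4 in the basis writes \<open>R\<close> as a sum of order 3 tensors times
  dual covectors. Applying \<open>a\<close> and the symmetrizer gives
  \<open>12 * kernel_form a\<close> times \<open>R\<close>, and this factor is invertible.\<close>

lemma curv_tensor_mem_span:
  fixes scale :: "'k::field_char_0 \<Rightarrow> 'v::ab_group_add \<Rightarrow> 'v"
  assumes V: "finite_dimensional_vector_space scale Basis" and a: "a \<in> \<rr>" "kernel_form a
      \<noteq> 0"
    and R: "R \<in> curv_tensors scale"
  shows "R \<in> tensor_span (young4 ` class_prods scale \<rr> (tensors scale 1))"
proof -
  interpret finite_dimensional_vector_space scale Basis by fact
  have T: "R \<in> tensors scale 4" using R by (simp add: curv_tensors_iff)
  have "R (v(4 := b)) = R (fix45 b b v)" for v b
    by (rule tensors_cong[OF T]) (auto simp: fix45_def)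
  then have "R v = (\<Sum>b\<in>Basis. tensor_prod 3 (\<lambda>v. R (fix45 b b v)) (\<lambda>v.
      coord scale Basis b (v 1)) v)" for v
    unfolding tensors_expand[OF V T, of 4 v, simplified]
    by (simp add: tensor_prod_def coord_def mult.commute)
  then have "young4 (gr_act 3 a R) \<in> tensor_span (young4 ` class_prods scale \<rr> (tensors scale 1))"
  proof (rule tensor_span_class_prods[OF order_refl a(1)])
    show "(\<lambda>v. R (fix45 b b v)) \<in> tensors scale 3" for b
      by (rule fix45_tensors[OF vector_space_axioms T]) simp
  qed (rule coord_tensors1[OF V])
  \<comment> \<open>Scaling is expressed as a linear combination with one term.\<close>
  then have "(\<lambda>v. \<Sum>k\<in>{()}. (1 / (12 * kernel_form a)) * young4 (gr_act 3 a R) v)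
      \<in> tensor_span (young4 ` class_prods scale \<rr> (tensors scale 1))"
    by (rule tensor_span_lincomb)
  then show ?thesis
    unfolding young4_curv_tensor[OF vector_space_axioms R] using a(2) by simp
qed

text \<open>Here slots 4 and 5 are both expanded, and \<open>swap45\<close> makes the second factors
  members of \<open>swap_forms scale e\<close> without changing the multiple of
  \<open>R\<close>.\<close>

lemma deriv_curv_tensor_mem_span:
  fixes scale :: "'k::field_char_0 \<Rightarrow> 'v::ab_group_add \<Rightarrow> 'v"
  assumes V: "finite_dimensional_vector_space scale Basis" and a: "a \<in> \<rr>" "kernel_form a
      \<noteq> 0"
    and R: "R \<in> deriv_curv_tensors scale" and e: "e * e = 1"
  shows "R \<in> tensor_span (young5 ` class_prods scale \<rr> (swap_forms scale e))"
proof -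
  interpret finite_dimensional_vector_space scale Basis by fact
  have T: "R \<in> tensors scale 5" using R by (simp add: deriv_curv_tensors_iff)
  have sub: "swap_forms scale e \<subseteq> tensors scale 2" by (auto simp: swap_forms_def)
  let ?c = "coord scale Basis"
  have "R (v(4 := b, 5 := b')) = R (fix45 b b' v)" for v b b'
    by (rule tensors_cong[OF T]) (auto simp: fix45_def)
  then have expand: "R v = (\<Sum>(b, b')\<in>Basis \<times> Basis. ?c b (v 4) * ?c b' (v 5) * R
      (fix45 b b' v))" for v
    unfolding tensors_expand[OF V T, of 4 v, simplified] tensors_expand[OF V T, of 5 "v(4 := b)"
        for b, simplified]
    by (simp add: coord_def sum.cartesian_product[symmetric] sum_distrib_left mult.assoc)
  have fix_swap: "fix45 b b' (\<lambda>i. v (transpose 4 5 i)) = fix45 b b' v" for b b' and v ::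
      "nat \<Rightarrow> 'v"
    by (auto simp: fix45_def fun_eq_iff transpose_def)
  have "swap45 e R v = (\<Sum>k\<in>Basis \<times> Basis. tensor_prod 3 (\<lambda>v. R (fix45 (fst
      k) (snd k) v))
      (\<lambda>v. ?c (fst k) (v 1) * ?c (snd k) (v 2) + e * (?c (fst k) (v 2) * ?c (snd k) (v 1)))
          v)" for v
    unfolding swap45_def expand[of v] expand[of "\<lambda>i. v (transpose 4 5 i)"] fix_swap
        sum_distrib_left sum.distrib[symmetric]
    by (rule sum.cong) (auto simp: tensor_prod_def algebra_simps)
  then have "young5 (gr_act 3 a (swap45 e R)) \<in> tensor_span (young5 ` class_prods scale \<rr>
      (swap_forms scale e))"
  proof (rule tensor_span_class_prods[OF sub a(1)])
    show "(\<lambda>v. R (fix45 (fst k) (snd k) v)) \<in> tensors scale 3" for k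
      by (rule fix45_tensors[OF vector_space_axioms T]) simp
  qed (rule coord_swap_forms[OF V e])
  then have "(\<lambda>v. \<Sum>k\<in>{()}. (1 / (24 * kernel_form a)) * young5 (gr_act 3 a (swap45
      e R)) v)
      \<in> tensor_span (young5 ` class_prods scale \<rr> (swap_forms scale e))"
    by (rule tensor_span_lincomb)
  then show ?thesis
    unfolding young5_deriv_curv_tensor[OF vector_space_axioms R] using a(2) by simp
qed

text \<open>Antisymmetry of the coefficients under left multiplication by \<open>s13\<close> becomes
  antisymmetry of the first factor in slots 1 and 3; the second factor reads later slots
  only.\<close>

lemma class_prods_r0_antisym:
  fixes scale :: "'k::field_char_0 \<Rightarrow> 'v::ab_group_add \<Rightarrow> 'v"
  assumes V: "vector_space scale" and Q: "Q \<subseteq> tensors scale m" and T: "T \<in>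
      class_prods scale r0 Q"
  shows "T (tuple (y # x # w # zs)) = - T (tuple (w # x # y # zs))"
proof -
  obtain a T' S where T: "T = tensor_prod 3 (gr_act 3 a T') S" "a \<in> r0" "T' \<in> tensors scale
      3" "S \<in> Q"
    using T unfolding class_prods_def symmetry_class_def by blast
  let ?U = "gr_act 3 a T'" and ?v = "tuple (w # x # y # zs)"
  \<comment> \<open>Reindexing by \<open>s13 \<circ> p\<close> makes the inner \<open>s13\<close>
    cancel the outer one.\<close>
  have "?U (\<lambda>i. ?v (s13 i)) = (\<Sum>p | p permutes {1..3}. a (s13 \<circ> p) * T'
      (\<lambda>i. ?v (s13 ((s13 \<circ> p) i))))"
    unfolding gr_act_def by (rule setum_permutations_compose_left[OF permutes_S3(2)])
  also have "\<dots> = (\<Sum>p | p permutes {1..3}. - (a p * T' (\<lambda>i. ?v (p i))))"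
  proof (rule sum.cong[OF refl])
    fix p assume "p \<in> {p. p permutes {1..3::nat}}"
    then have "a (s13 \<circ> p) = - a p" by (intro r0_antisym[OF T(2)]) simp
    moreover have "s13 (s13 i) = i" for i using S3_compose(1) by (simp add: fun_eq_iff)
    ultimately show "a (s13 \<circ> p) * T' (\<lambda>i. ?v (s13 ((s13 \<circ> p) i))) = - (a p *
        T' (\<lambda>i. ?v (p i)))" by simp
  qed
  also have "\<dots> = - ?U ?v" by (simp add: gr_act_def sum_negf)
  also have "?U (\<lambda>i. ?v (s13 i)) = ?U (tuple (y # x # w # zs))"
  proof (rule tensors_cong[OF gr_act_tensors[OF V T(3)]])
    fix i :: nat assume "i \<in> {1..3}"
    then have "i = 1 \<or> i = 2 \<or> i = 3" by auto
    then show "?v (s13 i) = tuple (y # x # w # zs) i"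
      by (elim disjE) (simp_all only: S3_eval tuple_nth)
  qed
  finally have U: "?U (tuple (y # x # w # zs)) = - ?U ?v" .
  have S: "S \<in> tensors scale m" using T(4) Q by blast
  \<comment> \<open>Only \<open>i \<ge> 1\<close> is relevant: positions count from 1, so
    \<open>3 + i\<close> lies past the three exchanged vectors, whereas \<open>i = 0\<close> would
    still hit one of them.\<close>
  have "S (\<lambda>i. tuple (y # x # w # zs) (3 + i)) = S (\<lambda>i. ?v (3 + i))"
  proof (rule tensors_cong[OF S])
    fix i :: nat assume "i \<in> {1..m}"
    then obtain j where "i = Suc j" by (cases i) auto
    then show "tuple (y # x # w # zs) (3 + i) = ?v (3 + i)" by (simp add: tuple_def)
  qed
  then show ?thesis unfolding T(1) tensor_prod_def U by simp
qed

lemma young4_class_prods_r0: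
  fixes scale :: "'k::field_char_0 \<Rightarrow> 'v::ab_group_add \<Rightarrow> 'v"
  assumes V: "vector_space scale" and T: "T \<in> class_prods scale r0 (tensors scale 1)"
  shows "young4 T = 0"
proof -
  have T': "T \<in> tensors scale 4" using class_prods_tensors[OF V order_refl[of "tensors scale
      1"]] T by auto
  have anti: "curry4 T y x w z = - curry4 T w x y z" for w x y z
    unfolding curry4_def by (rule class_prods_r0_antisym[OF V order_refl T])
  show ?thesis
    unfolding fun_eq_iff young4_eq[OF T'] alt_pairs_def sym_rows4_antisym_eq_0[of "curry4 T", OF
        anti] by simp
qed

lemma young5_class_prods_r0:
  fixes scale :: "'k::field_char_0 \<Rightarrow> 'v::ab_group_add \<Rightarrow> 'v"
  assumes V: "vector_space scale" and Q: "Q \<subseteq> tensors scale 2" and T: "T \<in>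
      class_prods scale r0 Q"
  shows "young5 T = 0"
proof -
  have T': "T \<in> tensors scale 5" using class_prods_tensors[OF V Q] T by auto
  have anti: "curry5 T y x w z u = - curry5 T w x y z u" for w x y z u
    unfolding curry5_def by (rule class_prods_r0_antisym[OF V Q T])
  show ?thesis
    unfolding fun_eq_iff young5_eq[OF T'] alt_pairs_def sym_rows5_antisym_eq_0[of "curry5 T", OF
        anti] by simp
qed

lemma tensor_span_zero: "X \<subseteq> {0} \<Longrightarrow> tensor_span X \<subseteq> {0}"
  unfolding tensor_span_def
  by (rule module.span_minimal[OF module_fun]) (simp_all add: module.subspace_single_0[OF module_fun])

text \<open>Two basis vectors exist since the dimension is at least 2. With \<open>\<omega>\<close>
  the wedge of their dual covectors \<open>\<alpha>\<close> and \<open>\<beta>\<close>, the first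
  Bianchi identity expresses that \<open>\<omega>\<close> wedge \<open>\<omega>\<close> is 0, the
  second that \<open>\<omega>\<close> wedge \<open>\<alpha>\<close> is 0.\<close>

lemma nonzero_curv_tensors:
  fixes scale :: "'k::field_char_0 \<Rightarrow> 'v::ab_group_add \<Rightarrow> 'v"
  assumes V: "finite_dimensional_vector_space scale Basis"
    and dim: "vector_space.dim scale (UNIV :: 'v set) \<ge> 2"
  shows "\<not> curv_tensors scale \<subseteq> {0}" "\<not> deriv_curv_tensors scale \<subseteq> {0}"
proof -
  interpret finite_dimensional_vector_space scale Basis by fact
  have "2 \<le> card Basis" using dim by simp
  then obtain B where "B \<subseteq> Basis" "card B = 2" by (rule obtain_subset_with_card_n)
  then obtain b b' where b: "b \<in> Basis" "b' \<in> Basis" "b \<noteq> b'"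
    by (auto simp: card_2_iff)
  define \<alpha> where "\<alpha> = coord scale Basis b"
  define \<beta> where "\<beta> = coord scale Basis b'"
  define \<omega> where "\<omega> x y = \<alpha> x * \<beta> y - \<alpha> y * \<beta> x" for x y
  define R :: "(nat \<Rightarrow> 'v) \<Rightarrow> 'k" where "R v = \<omega> (v 1) (v 2) *
      \<omega> (v 3) (v 4)" for v
  define R' :: "(nat \<Rightarrow> 'v) \<Rightarrow> 'k" where "R' v = \<omega> (v 1) (v 2) *
      \<omega> (v 3) (v 4) * \<alpha> (v 5)" for v
  have lin: "\<alpha> (x + y) = \<alpha> x + \<alpha> y" "\<alpha> (scale c x) = c * \<alpha> x"
    "\<beta> (x + y) = \<beta> x + \<beta> y" "\<beta> (scale c x) = c * \<beta> x" for x y c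
    unfolding \<alpha>_def \<beta>_def by (rule coord_linear[OF V])+
  have vals: "\<alpha> b = 1" "\<alpha> b' = 0" "\<beta> b = 0" "\<beta> b' = 1"
    unfolding \<alpha>_def \<beta>_def using b by (simp_all add: coord_Basis[OF V])
  have 4: "i \<in> {1..4} \<longleftrightarrow> i = 1 \<or> i = 2 \<or> i = 3 \<or> i = 4" for i ::
      nat by auto
  have 5: "i \<in> {1..5} \<longleftrightarrow> i = 1 \<or> i = 2 \<or> i = 3 \<or> i = 4 \<or> i =
      5" for i :: nat by auto
  have "R \<in> tensors scale 4"
    unfolding tensors_iff[OF vector_space_axioms] R_def \<omega>_def 4 by (auto simp: lin algebra_simps)
  moreover have "curv_form (curry4 R)"
    unfolding curv_form_def curry4_def R_def \<omega>_def tuple_nth by (auto simp: algebra_simps)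
  ultimately have "R \<in> curv_tensors scale" by (simp add: curv_tensors_iff)
  moreover have "R (tuple [b, b', b, b']) \<noteq> 0"
    unfolding R_def \<omega>_def tuple_nth vals by simp
  ultimately show "\<not> curv_tensors scale \<subseteq> {0}" by (auto simp: subset_iff fun_eq_iff)
  have "R' \<in> tensors scale 5"
    unfolding tensors_iff[OF vector_space_axioms] R'_def \<omega>_def 5 by (auto simp: lin algebra_simps)
  moreover have "deriv_curv_form (curry5 R')"
    unfolding deriv_curv_form_def curv_form_def curry5_def R'_def \<omega>_def tuple_nth by (auto
        simp: algebra_simps)
  ultimately have "R' \<in> deriv_curv_tensors scale" by (simp add: deriv_curv_tensors_iff)
  moreover have "R' (tuple [b, b', b, b', b]) \<noteq> 0"
    unfolding R'_def \<omega>_def tuple_nth vals by simp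
  ultimately show "\<not> deriv_curv_tensors scale \<subseteq> {0}" by (auto simp: subset_iff fun_eq_iff)
qed

section \<open>The equivalences\<close>

lemma exists_kernel_form_nonzero:
  fixes \<rr> :: "((nat \<Rightarrow> nat) \<Rightarrow> 'k::field_char_0) set"
  assumes min: "minimal_right_ideal \<rr> KS3" and 21: "belongs_to \<rr> [2, 1]" and "\<rr> \<noteq> r0"
  shows "\<exists>a\<in>\<rr>. kernel_form a \<noteq> 0"
proof (rule ccontr)
  assume "\<not> (\<exists>a\<in>\<rr>. kernel_form a \<noteq> 0)"
  then have ker: "a id + a s13 = a s12 + a (s13 \<circ> s12)" if "a \<in> \<rr>" for a
    using that by (auto simp: kernel_form_def algebra_simps)
  have \<rr>: "right_ideal \<rr> KS3" "\<rr> \<noteq> {\<zero>\<^bsub>KS3\<^esub>}"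
    using min by (simp_all add: minimal_right_ideal_def)
  have sums: "a id + a (s13 \<circ> s12) + a (s13 \<circ> s23) = 0" "a s13 + a s12 + a s23 = 0" if
      "a \<in> \<rr>" for a
    by (rule S3_even_sum; rule belongs_to_21_char_sum[OF 21 _ that]; simp add: lin_char_def)+
  \<comment> \<open>If the functional vanished on \<open>\<rr>\<close>, then, being in the block of
    (2 1), all elements would be antisymmetric under \<open>s13\<close>, which forces
    \<open>\<rr>\<close> to be the exceptional ideal.\<close>
  have "\<rr> = r0"
    using right_ideal_eq_r0[OF \<rr> sums(1) right_ideal_antisym[OF \<rr>(1) sums ker]] .
  with \<open>\<rr> \<noteq> r0\<close> show False ..
qed

theorem theorem1p5:
  fixes scale :: "'k::field_char_0 \<Rightarrow> 'v::ab_group_add \<Rightarrow> 'v"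
    and Basis :: "'v set"
    and \<rr> :: "((nat \<Rightarrow> nat) \<Rightarrow> 'k) set"
  assumes K: "(\<exists>\<phi> :: 'k \<Rightarrow> real. field_iso \<phi>) \<or> (\<exists>\<phi>
      :: 'k \<Rightarrow> complex. field_iso \<phi>)"
    and V: "finite_dimensional_vector_space scale Basis"
    and dim: "vector_space.dim scale (UNIV :: 'v set) \<ge> 2"
    and r_min: "minimal_right_ideal \<rr> (group_ring 3)"
    and r_21: "belongs_to \<rr> [2, 1]"
  shows
    "(curv_tensors scale =
        tensor_span {gr_act 4 (gr_star 4 (young_symmetrizer [[1, 3], [2, 4]])) (tensor_prod 3 U w) | U w.
          U \<in> symmetry_class scale 3 \<rr> \<and> w \<in> tensors scale 1}
      \<longleftrightarrow>
      deriv_curv_tensors scale =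
        tensor_span {gr_act 5 (gr_star 5 (young_symmetrizer [[1, 3, 5], [2, 4]])) (tensor_prod 3 U
            S) | U S.
          U \<in> symmetry_class scale 3 \<rr> \<and> S \<in> sym_forms scale})
     \<and>
     (deriv_curv_tensors scale =
        tensor_span {gr_act 5 (gr_star 5 (young_symmetrizer [[1, 3, 5], [2, 4]])) (tensor_prod 3 U
            S) | U S.
          U \<in> symmetry_class scale 3 \<rr> \<and> S \<in> sym_forms scale}
      \<longleftrightarrow>
      deriv_curv_tensors scale =
        tensor_span {gr_act 5 (gr_star 5 (young_symmetrizer [[1, 3, 5], [2, 4]])) (tensor_prod 3 U
            A) | U A.
          U \<in> symmetry_class scale 3 \<rr> \<and> A \<in> alt_forms scale})
     \<and>
     (deriv_curv_tensors scale =
        tensor_span {gr_act 5 (gr_star 5 (young_symmetrizer [[1, 3, 5], [2, 4]])) (tensor_prod 3 U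
            A) | U A.
          U \<in> symmetry_class scale 3 \<rr> \<and> A \<in> alt_forms scale}
      \<longleftrightarrow> \<rr> \<noteq> r0)"
proof -
  interpret finite_dimensional_vector_space scale Basis by fact
  have forms: "sym_forms scale = swap_forms scale 1" "alt_forms scale = swap_forms scale (- 1)"
    by (auto simp: sym_forms_def alt_forms_def swap_forms_def)
  have sub: "swap_forms scale e \<subseteq> tensors scale 2" for e
    by (auto simp: swap_forms_def)
  \<comment> \<open>Each spanning statement is separately equivalent to
    \<open>\<rr> \<noteq> r0\<close>; the chain of equivalences then follows at once.\<close>
  have 4: "curv_tensors scale = tensor_span (young4 ` class_prods scale \<rr> (tensors scale 1))
      \<longleftrightarrow> \<rr> \<noteq> r0"
  proof
    assume "\<rr> \<noteq> r0"
    then obtain a where a: "a \<in> \<rr>" "kernel_form a \<noteq> 0"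
      using exists_kernel_form_nonzero[OF r_min r_21] by blast
    have "young4 ` class_prods scale \<rr> (tensors scale 1) \<subseteq> young4 ` tensors scale 4"
      using class_prods_tensors[OF vector_space_axioms order_refl[of "tensors scale 1"], of \<rr>] by auto
    then have "tensor_span (young4 ` class_prods scale \<rr> (tensors scale 1)) \<subseteq>
        curv_tensors scale"
      using tensor_span_gr_act_subset[OF vector_space_axioms] curv_tensors_young4[OF
          vector_space_axioms] by blast
    moreover have "curv_tensors scale \<subseteq> tensor_span (young4 ` class_prods scale \<rr>
        (tensors scale 1))"
      using curv_tensor_mem_span[OF V a] by blast
    ultimately show "curv_tensors scale = tensor_span (young4 ` class_prods scale \<rr> (tensors
        scale 1))" by blast
  next
    assume eq: "curv_tensors scale = tensor_span (young4 ` class_prods scale \<rr> (tensors scale 1))"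
    show "\<rr> \<noteq> r0"
    proof
      \<comment> \<open>For the exceptional ideal all generators are symmetrized to 0, but nonzero
        curvature tensors exist.\<close>
      assume "\<rr> = r0"
      then have "young4 ` class_prods scale \<rr> (tensors scale 1) \<subseteq> {0}"
        using young4_class_prods_r0[OF vector_space_axioms] by blast
      then show False
        using nonzero_curv_tensors(1)[OF V dim] tensor_span_zero unfolding eq by blast
    qed
  qed
  \<comment> \<open>Statements (2) and (3) are the instances \<open>e = 1\<close> and
    \<open>e = - 1\<close>.\<close>
  have 5: "deriv_curv_tensors scale = tensor_span (young5 ` class_prods scale \<rr> (swap_forms
      scale e)) \<longleftrightarrow> \<rr> \<noteq> r0"
    if e: "e * e = 1" for e
  proof
    assume "\<rr> \<noteq> r0"
    then obtain a where a: "a \<in> \<rr>" "kernel_form a \<noteq> 0"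
      using exists_kernel_form_nonzero[OF r_min r_21] by blast
    have "young5 ` class_prods scale \<rr> (swap_forms scale e) \<subseteq> young5 ` tensors scale 5"
      using class_prods_tensors[OF vector_space_axioms sub, of \<rr>] by auto
    then have "tensor_span (young5 ` class_prods scale \<rr> (swap_forms scale e)) \<subseteq>
        deriv_curv_tensors scale"
      using tensor_span_gr_act_subset[OF vector_space_axioms] deriv_curv_tensors_young5[OF
          vector_space_axioms] by blast
    moreover have "deriv_curv_tensors scale \<subseteq> tensor_span (young5 ` class_prods scale
        \<rr> (swap_forms scale e))"
      using deriv_curv_tensor_mem_span[OF V a _ e] by blast
    ultimately show "deriv_curv_tensors scale = tensor_span (young5 ` class_prods scale \<rr>
        (swap_forms scale e))" by blast
  next
    assume eq: "deriv_curv_tensors scale = tensor_span (young5 ` class_prods scale \<rr>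
        (swap_forms scale e))"
    show "\<rr> \<noteq> r0"
    proof
      assume "\<rr> = r0"
      then have "young5 ` class_prods scale \<rr> (swap_forms scale e) \<subseteq> {0}"
        using young5_class_prods_r0[OF vector_space_axioms sub] by blast
      then show False
        using nonzero_curv_tensors(2)[OF V dim] tensor_span_zero unfolding eq by blast
    qed
  qed
  show ?thesis
    unfolding class_prods_image forms 4 using 5[of 1] 5[of "- 1"] by simp
qed

end
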